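(* Let $p$ and $q$ be distinct primes with $q\geq 3$. For any integer $m\geq 1$, the class number of $\mathbb{Q}\left(\sqrt{q^2-4p^{q^m}}\right)$ is divisible by $q^m$.
   Context: The exponent of $p$ is $q^m$ ($q$ to the power $m$). *)

theory Defs
  imports Complex_Main "HOL-Computational_Algebra.Polynomial" "HOL-Algebra.Algebra"
    "HOL-Algebra.Algebraic_Closure_Type"
begin

text \<open>
  Number fields are taken as subfields of the complex numbers, given by their carrier sets. The
  generated field contains the rationals because the ambient field has characteristic zero.
\<close>

abbreviation complex_ring :: "complex ring" where
  "complex_ring \<equiv> ring_of_type_algebra"

definition quadratic_field :: "int \<Rightarrow> complex set" where
  "quadratic_field d = generate_field complex_ring {csqrt (of_int d)}"

definition ring_of_integers :: "complex set \<Rightarrow> complex ring" where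
  "ring_of_integers K = complex_ring\<lparr>carrier := {x \<in> K. algebraic_int x}\<rparr>"

text \<open>
  A fractional ideal is a nonzero subset \<open>I\<close> of \<open>K\<close> such that \<open>c I\<close> is an
  ideal of the ring of integers for some nonzero algebraic integer \<open>c\<close> of \<open>K\<close>.
\<close>

definition fractional_ideals :: "complex set \<Rightarrow> complex set set" where
  "fractional_ideals K = {I. I \<subseteq> K \<and> I \<noteq> {0} \<and>
     (\<exists>c \<in> carrier (ring_of_integers K). c \<noteq> 0 \<and> ideal ((*) c ` I) (ring_of_integers K))}"

definition principal_fractional_ideals :: "complex set \<Rightarrow> complex set set" where
  "principal_fractional_ideals K = {(*) x ` carrier (ring_of_integers K) | x. x \<in> K \<and> x \<noteq> 0}"

text \<open>
  The constant \<^const>\<open>ideal_prod\<close> forms the set of finite sums of products; instantiated with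
  the ambient ring, it is the product of fractional ideals.
\<close>

definition fractional_ideal_group :: "complex set \<Rightarrow> complex set monoid" where
  "fractional_ideal_group K =
     \<lparr>carrier = fractional_ideals K,
      monoid.mult = ideal_prod complex_ring,
      one = carrier (ring_of_integers K)\<rparr>"

definition class_group :: "complex set \<Rightarrow> complex set set monoid" where
  "class_group K = fractional_ideal_group K Mod principal_fractional_ideals K"

text \<open>
  Since \<^const>\<open>Coset.order\<close> is defined by \<^const>\<open>card\<close>, this would be \<open>0\<close> for an infinite class group.
\<close>

definition class_number :: "complex set \<Rightarrow> nat" where
  "class_number K = Coset.order (class_group K)"

end

theory Submission
  imports Defs "HOL-Analysis.Kronecker_Approximation_Theorem"
begin

text \<open>
  Put \<open>n = q ^ m\<close>, \<open>D = q\<^sup>2 - 4 p\<^sup>n\<close> and \<open>\<alpha> = (q + sqrt D) / 2\<close>. Since \<open>D < 0\<close>, the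
  field \<open>K\<close> is imaginary quadratic, and \<open>\<alpha>\<close> is an integer of \<open>K\<close> with trace \<open>q\<close> and norm \<open>p\<^sup>n\<close>.
  Trace and norm are coprime, so \<open>\<alpha>\<close> and its conjugate generate coprime ideals, and it follows that
  the ideal \<open>A = (p, \<alpha>)\<close> satisfies \<open>A\<^sup>n = (\<alpha>)\<close> (\<open>two_generated_ideal_power\<close>). Hence the order of the class
  of \<open>A\<close> is a power of \<open>q\<close> dividing \<open>q ^ m\<close>.

  Suppose that the order were smaller. Then \<open>A ^ (q ^ (m - 1))\<close> is principal, say generated by
  \<open>\<beta>\<close>, and \<open>\<alpha> = u \<beta>\<^sup>q\<close> with a unit \<open>u\<close>. Every unit of \<open>K\<close> is a \<open>q\<close>-th power
  (\<open>unit_prime_power\<close>): the units are fourth or sixth roots of unity, and the only conflict, \<open>q = 3\<close> in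
  the field of the cube roots of unity, would need \<open>3\<close> to divide \<open>D\<close>, that is \<open>p = 3 = q\<close>. So
  \<open>\<alpha> = \<gamma>\<^sup>q\<close> for an integer \<open>\<gamma>\<close> of \<open>K\<close>. But the trace of a \<open>q\<close>-th power is never \<open>q\<close>
  (\<open>trace_prime_power_neq\<close>): if \<open>a\<close> is the trace of \<open>\<gamma>\<close>, the trace of \<open>\<gamma>\<^sup>q\<close> is congruent to
  \<open>a\<^sup>q\<close> modulo \<open>q\<close>, so \<open>q\<close> divides \<open>a\<close>; and modulo \<open>a\<^sup>2\<close> it is a multiple of \<open>q a\<close>, so it
  would be divisible by \<open>q\<^sup>2\<close>. Therefore the class of \<open>A\<close> has order exactly \<open>q ^ m\<close>, and Lagrange's
  theorem applies.

  This needs the class group to be a finite group. Both facts are proved here directly for imaginary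
  quadratic fields. A fractional ideal is invertible because the product of an integral ideal with its
  conjugate is generated by a rational integer (\<open>integral_star_cnj_principal\<close>). Finiteness
  (\<open>finite_class_group\<close>) follows Hurwitz: simultaneous Diophantine approximation replaces division
  with remainder, and shows that every ideal class contains an ideal between \<open>M! \<O>\<close> and \<open>\<O>\<close>,
  where \<open>\<O>\<close> is the ring of integers and \<open>M\<close> depends only on \<open>K\<close>.
\<close>

section \<open>Algebraic integers of degree two\<close>

lemma algebraic_int_if_trace_norm_Ints:
  fixes x :: complex
  assumes "x + cnj x \<in> \<int>" and "x * cnj x \<in> \<int>"
  shows "algebraic_int x"
proof
  show "\<forall>i. Polynomial.coeff [:x * cnj x, - (x + cnj x), 1:] i \<in> \<int>"
    using assms Ints_minus[OF assms(1)] by (auto simp: coeff_pCons split: nat.splits)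
qed (auto simp: algebra_simps)

text \<open>
  Gauss's lemma in the case that is needed: the primitive integer multiple of the minimal polynomial of
  an algebraic integer has leading coefficient \<open>1\<close> or \<open>- 1\<close>. Pseudo-division avoids the passage to
  rational coefficients: the remainder has degree below two and a nonreal root, so it vanishes.
\<close>

lemma quadratic_algebraic_int_trace_norm:
  fixes x :: complex and P :: "int poly"
  assumes "algebraic_int x" and "x \<notin> \<real>"
    and P: "P \<noteq> 0" "Polynomial.degree P \<le> 2" "poly (map_poly of_int P) x = 0"
  shows "x + cnj x \<in> \<int> \<and> x * cnj x \<in> \<int>"
proof -
  define ev where "ev p = poly (map_poly of_int p) x" for p :: "int poly"
  have ev_0: "ev 0 = 0" and ev_pCons: "ev (pCons a p) = of_int a + x * ev p" for a p
    by (simp_all add: ev_def map_poly_pCons)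
  have ev_add: "ev (p + q) = ev p + ev q" for p q
    by (induction p q rule: poly_induct2) (simp_all add: ev_0 ev_pCons algebra_simps)
  have ev_smult: "ev (Polynomial.smult c p) = of_int c * ev p" for c p
    by (induction p) (simp_all add: ev_0 ev_pCons algebra_simps)
  have ev_mult: "ev (p * q) = ev p * ev q" for p q
    by (induction p) (simp_all add: ev_0 ev_pCons ev_add ev_smult algebra_simps)
  have root_small: "r = 0" if "ev r = 0" "r = 0 \<or> Polynomial.degree r < 2" for r
  proof (rule ccontr)
    assume "r \<noteq> 0"
    define a b where "a = Polynomial.coeff r 0" and "b = Polynomial.coeff r 1"
    have r: "r = [:a, b:]"
      using that(2) \<open>r \<noteq> 0\<close>
      by (intro poly_eqI) (auto simp: a_def b_def coeff_pCons coeff_eq_0 split: nat.splits)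
    have eq: "of_int a + x * of_int b = 0"
      using that(1) by (simp add: r ev_pCons ev_0)
    show False
    proof (cases "b = 0")
      case True
      then show False using eq \<open>r \<noteq> 0\<close> r by simp
    next
      case False
      then have "x = - of_int a / of_int b"
        using eq by (simp add: field_simps add_eq_0_iff)
      then show False
        using \<open>x \<notin> \<real>\<close> by simp
    qed
  qed
  define G where "G = primitive_part P"
  have "G \<noteq> 0" and cG: "Polynomial.content G = 1"
    using P(1) by (simp_all add: G_def)
  have "ev P = of_int (Polynomial.content P) * ev G"
    by (metis G_def content_times_primitive_part ev_smult)
  then have evG: "ev G = 0"
    using P(1,3) by (simp add: ev_def)
  have degG: "Polynomial.degree G = 2"
    using root_small[OF evG] \<open>G \<noteq> 0\<close> P(2) unfolding G_def by (metis degree_primitive_part le_neq_implies_less)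
  obtain f where evf: "ev f = 0" and lcf: "Polynomial.lead_coeff f = 1"
    using assms(1) by (auto simp: algebraic_int_altdef_ipoly ev_def)
  obtain g r where gr: "pseudo_divmod f G = (g, r)"
    by fastforce
  define c where "c = Polynomial.lead_coeff G ^ (Suc (Polynomial.degree f) - Polynomial.degree G)"
  have div: "Polynomial.smult c f = G * g + r" "r = 0 \<or> Polynomial.degree r < 2"
    using pseudo_divmod[OF \<open>G \<noteq> 0\<close> gr] degG by (auto simp: c_def)
  have "ev r = 0"
    using arg_cong[OF div(1), of ev] by (simp add: ev_smult ev_add ev_mult evf evG)
  then have "r = 0"
    using root_small div(2) by blast
  have "Polynomial.content f = 1"
    using lcf content_dvd_coeff[of f "Polynomial.degree f"]
    by (metis abs_1 normalize_int_def normalize_content zdvd1_eq)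
  have "Polynomial.content g = Polynomial.content (Polynomial.smult c f)"
    using div(1) \<open>r = 0\<close> cG by (simp add: content_mult)
  also have "\<dots> = \<bar>c\<bar>"
    using \<open>Polynomial.content f = 1\<close> by (simp add: content_smult normalize_int_def)
  finally have "c dvd Polynomial.content g"
    by simp
  then have "[:c:] dvd g"
    by (simp add: const_poly_dvd_iff_dvd_content)
  then obtain g' where "g = Polynomial.smult c g'"
    by (auto elim!: dvdE)
  moreover have "c \<noteq> 0"
    using \<open>G \<noteq> 0\<close> by (simp add: c_def)
  ultimately have "f = G * g'"
    using div(1) \<open>r = 0\<close> by (metis mult_smult_right add.right_neutral smult_cancel)
  then have "Polynomial.lead_coeff G dvd 1"
    using lcf by (metis dvd_triv_left lead_coeff_mult)
  moreover define c0 c1 c2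
    where "c0 = Polynomial.coeff G 0" and "c1 = Polynomial.coeff G 1" and "c2 = Polynomial.coeff G 2"
  ultimately have "c2 dvd 1"
    using degG by simp
  have G: "G = [:c0, c1, c2:]"
    using degG
    by (intro poly_eqI)
      (auto simp: c0_def c1_def c2_def coeff_pCons coeff_eq_0 numeral_2_eq_2 split: nat.splits)
  have c2: "c2 = 1 \<or> c2 = -1"
    using \<open>c2 dvd 1\<close> by auto
  have eq: "of_int c0 + x * (of_int c1 + x * of_int c2) = 0"
    using evG by (simp add: G ev_pCons ev_0)
  then have eq': "of_int c0 + cnj x * (of_int c1 + cnj x * of_int c2) = 0"
    by (metis complex_cnj_add complex_cnj_mult complex_cnj_of_int complex_cnj_zero)
  have "(x - cnj x) * (of_int c1 + (x + cnj x) * of_int c2) = 0"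
  proof -
    have "(x - cnj x) * (of_int c1 + (x + cnj x) * of_int c2)
        = (of_int c0 + x * (of_int c1 + x * of_int c2))
          - (of_int c0 + cnj x * (of_int c1 + cnj x * of_int c2))"
      by (simp add: algebra_simps)
    then show ?thesis
      using eq eq' by simp
  qed
  then have tr: "of_int c1 + (x + cnj x) * of_int c2 = 0"
    using \<open>x \<notin> \<real>\<close> Reals_cnj_iff by auto
  have nm: "x * cnj x * of_int c2 = of_int c0"
  proof -
    have "x * cnj x * of_int c2 = of_int c0 + x * (of_int c1 + (x + cnj x) * of_int c2)
        - (of_int c0 + x * (of_int c1 + x * of_int c2))"
      by (simp add: algebra_simps)
    then show ?thesis
      using eq tr by simp
  qed
  from c2 show ?thesis
  proof
    assume "c2 = 1"
    then have "x + cnj x = of_int (- c1)" "x * cnj x = of_int c0"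
      using tr nm by (simp_all add: add_eq_0_iff)
    then show ?thesis by (metis Ints_of_int)
  next
    assume "c2 = -1"
    then have "x + cnj x = of_int c1" "- (x * cnj x) = of_int c0"
      using tr nm by (auto simp: add_eq_0_iff algebra_simps)
    then show ?thesis by (metis Ints_of_int Ints_minus minus_minus)
  qed
qed

section \<open>Power sums of two numbers with integral sum and product\<close>

text \<open>
  The power sums \<open>V\<^sub>n = x\<^sup>n + y\<^sup>n\<close> satisfy \<open>V\<^sub>n\<^sub>+\<^sub>2 = a V\<^sub>n\<^sub>+\<^sub>1 - P V\<^sub>n\<close>. Modulo \<open>a\<^sup>2\<close>
  this recurrence has an explicit solution, which for odd \<open>n\<close> is a multiple of \<open>n a\<close>.
\<close>

lemma power_sums_mod_trace_square:
  fixes x y :: complex and a P :: int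
  assumes a: "x + y = of_int a" and P: "x * y = of_int P"
  shows "\<exists>r s. x ^ (2 * k) + y ^ (2 * k) = of_int (2 * (- P) ^ k + a\<^sup>2 * r) \<and>
    x ^ (2 * k + 1) + y ^ (2 * k + 1) = of_int ((2 * int k + 1) * a * (- P) ^ k + a\<^sup>2 * s)"
proof (induction k)
  case 0
  show ?case
    using a by (intro exI[of _ 0]) simp
next
  case (Suc k)
  have rec: "x ^ (n + 2) + y ^ (n + 2)
      = of_int a * (x ^ (n + 1) + y ^ (n + 1)) - of_int P * (x ^ n + y ^ n)" for n
    by (simp add: a[symmetric] P[symmetric] algebra_simps)
  obtain r s where r: "x ^ (2 * k) + y ^ (2 * k) = of_int (2 * (- P) ^ k + a\<^sup>2 * r)"
    and s: "x ^ (2 * k + 1) + y ^ (2 * k + 1) = of_int ((2 * int k + 1) * a * (- P) ^ k + a\<^sup>2 * s)"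
    using Suc.IH by blast
  define r' where "r' = (2 * int k + 1) * (- P) ^ k + a * s - P * r"
  define s' where "s' = a * r' - P * s"
  have r'': "x ^ (2 * k + 2) + y ^ (2 * k + 2) = of_int (2 * (- P) ^ Suc k + a\<^sup>2 * r')"
    unfolding rec r s r'_def by (simp add: algebra_simps power2_eq_square)
  have "x ^ (2 * k + 3) + y ^ (2 * k + 3)
      = of_int a * (x ^ (2 * k + 2) + y ^ (2 * k + 2)) - of_int P * (x ^ (2 * k + 1) + y ^ (2 * k + 1))"
    using rec[of "2 * k + 1"] by (simp add: numeral_3_eq_3)
  also have "\<dots> = of_int ((2 * int (Suc k) + 1) * a * (- P) ^ Suc k + a\<^sup>2 * s')"
    unfolding r'' s s'_def by (simp add: algebra_simps power2_eq_square)
  finally have "x ^ (2 * k + 3) + y ^ (2 * k + 3)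
      = of_int ((2 * int (Suc k) + 1) * a * (- P) ^ Suc k + a\<^sup>2 * s')" .
  then show ?case
    using r'' by (intro exI[of _ r'] exI[of _ s'] conjI) (simp_all add: numeral_3_eq_3)
qed

section \<open>Imaginary quadratic fields and their integers\<close>

lemma complex_ring_simps [simp]:
  "carrier complex_ring = UNIV"
  "x \<otimes>\<^bsub>complex_ring\<^esub> y = x * y"
  "x \<oplus>\<^bsub>complex_ring\<^esub> y = x + y"
  "\<one>\<^bsub>complex_ring\<^esub> = 1"
  "\<zero>\<^bsub>complex_ring\<^esub> = 0"
  by (simp_all add: ring_of_type_algebra_def)

interpretation complex_ring: cring complex_ring
  by (rule cring_from_type_algebra)

lemma complex_ring_a_inv [simp]: "\<ominus>\<^bsub>complex_ring\<^esub> x = - x"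
  using complex_ring.minus_equality[of "- x" x] by simp

lemma complex_ring_m_inv [simp]:
  assumes "x \<noteq> 0"
  shows "inv\<^bsub>complex_ring\<^esub> x = inverse x"
  using complex_ring.comm_inv_char[of x "inverse x"] assms by simp

lemma cnj_Rats: "x \<in> \<rat> \<Longrightarrow> cnj x = x"
  by (elim Rats_cases') simp

text \<open>
  All constructions are carried out with the arithmetic of the complex numbers; complex conjugation is
  the nontrivial automorphism of the field, so traces and norms are \<open>x + cnj x\<close> and \<open>x * cnj x\<close>.
\<close>

locale imaginary_quadratic =
  fixes D :: int
  assumes D_neg: "D < 0"
begin

definition sqrtD :: complex where "sqrtD = csqrt (of_int D)"

abbreviation K :: "complex set" where "K \<equiv> quadratic_field D"

definition \<O> :: "complex set" where "\<O> = {x \<in> K. algebraic_int x}"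

lemma sqrtD_square: "sqrtD * sqrtD = of_int D"
  using power2_csqrt[of "of_int D"] by (simp add: sqrtD_def power2_eq_square)

lemma sqrtD_eq: "sqrtD = \<i> * sqrt (- of_int D)"
  using csqrt_of_real_nonpos[of "of_int D"] D_neg by (simp add: sqrtD_def)

lemma cnj_sqrtD: "cnj sqrtD = - sqrtD"
  by (simp add: sqrtD_eq)

lemma K_one: "1 \<in> K"
  using generate_field.one[of complex_ring] by (simp add: quadratic_field_def)

lemma K_sqrtD: "sqrtD \<in> K"
  by (simp add: quadratic_field_def sqrtD_def generate_field.incl)

lemma K_add: "x \<in> K \<Longrightarrow> y \<in> K \<Longrightarrow> x + y \<in> K"
  using generate_field.eng_add[of _ complex_ring] by (simp add: quadratic_field_def)

lemma K_mult: "x \<in> K \<Longrightarrow> y \<in> K \<Longrightarrow> x * y \<in> K"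
  using generate_field.eng_mult[of _ complex_ring] by (simp add: quadratic_field_def)

lemma K_uminus: "x \<in> K \<Longrightarrow> - x \<in> K"
  using generate_field.a_inv[of _ complex_ring] by (simp add: quadratic_field_def)

lemma K_0: "0 \<in> K"
  using K_add[OF K_one K_uminus[OF K_one]] by simp

lemma K_inverse: "x \<in> K \<Longrightarrow> inverse x \<in> K"
  using generate_field.m_inv[of x complex_ring] K_0
  by (cases "x = 0") (simp_all add: quadratic_field_def)

lemma K_of_int: "of_int n \<in> K"
proof (induction n rule: int_induct[where k = 0])
  case (step1 i)
  then show ?case using K_add[OF _ K_one] by simp
next
  case (step2 i)
  then show ?case using K_add[OF _ K_uminus[OF K_one]] by simp
qed (simp add: K_0)

lemma K_Rats: "x \<in> \<rat> \<Longrightarrow> x \<in> K"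
  by (elim Rats_cases') (simp add: divide_inverse K_mult K_inverse K_of_int)

lemma K_iff: "x \<in> K \<longleftrightarrow> (\<exists>a\<in>\<rat>. \<exists>b\<in>\<rat>. x = a + b * sqrtD)"
proof
  assume "x \<in> K"
  then show "\<exists>a\<in>\<rat>. \<exists>b\<in>\<rat>. x = a + b * sqrtD"
    unfolding quadratic_field_def
  proof (induction rule: generate_field.induct)
    case one
    show ?case by (intro bexI[of _ 1] bexI[of _ 0]) simp_all
  next
    case (incl h)
    then show ?case by (intro bexI[of _ 0] bexI[of _ 1]) (simp_all add: sqrtD_def)
  next
    case (a_inv h)
    then obtain a b where "a \<in> \<rat>" "b \<in> \<rat>" "h = a + b * sqrtD" by blast
    then show ?case by (intro bexI[of _ "- a"] bexI[of _ "- b"]) simp_all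
  next
    case (m_inv h)
    then obtain a b where ab: "a \<in> \<rat>" "b \<in> \<rat>" "h = a + b * sqrtD" by blast
    define n where "n = a * a - b * b * of_int D"
    have "(a + b * sqrtD) * (a - b * sqrtD) = a * a - b * b * (sqrtD * sqrtD)"
      by (simp add: algebra_simps)
    then have hn: "h * (a - b * sqrtD) = n"
      unfolding n_def ab(3) sqrtD_square .
    have "h \<noteq> 0" using m_inv by simp
    have "n \<in> \<rat>" using ab by (simp add: n_def)
    have "cnj h = a - b * sqrtD"
      unfolding ab(3) by (simp add: cnj_Rats[OF ab(1)] cnj_Rats[OF ab(2)] cnj_sqrtD)
    then have "a - b * sqrtD \<noteq> 0"
      using \<open>h \<noteq> 0\<close> complex_cnj_zero_iff[of h] by simp
    then have "n \<noteq> 0"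
      using hn \<open>h \<noteq> 0\<close> by auto
    have "h * (a / n + (- b / n) * sqrtD) = h * (a - b * sqrtD) / n"
      by (simp add: diff_divide_distrib algebra_simps)
    then have "h * (a / n + (- b / n) * sqrtD) = 1"
      using hn \<open>n \<noteq> 0\<close> by simp
    then have "inverse h = a / n + (- b / n) * sqrtD"
      by (rule inverse_unique)
    then have "inv\<^bsub>complex_ring\<^esub> h = a / n + (- b / n) * sqrtD"
      by (simp only: complex_ring_m_inv[OF \<open>h \<noteq> 0\<close>])
    moreover have "a / n \<in> \<rat>" "- b / n \<in> \<rat>"
      using ab(1,2) \<open>n \<in> \<rat>\<close> by simp_all
    ultimately show ?case by blast
  next
    case (eng_add h1 h2)
    then obtain a b c d where "a \<in> \<rat>" "b \<in> \<rat>" "c \<in> \<rat>" "d \<in> \<rat>"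
      "h1 = a + b * sqrtD" "h2 = c + d * sqrtD" by blast
    then show ?case
      by (intro bexI[of _ "a + c"] bexI[of _ "b + d"]) (simp_all add: algebra_simps)
  next
    case (eng_mult h1 h2)
    then obtain a b c d where *: "a \<in> \<rat>" "b \<in> \<rat>" "c \<in> \<rat>" "d \<in> \<rat>"
      "h1 = a + b * sqrtD" "h2 = c + d * sqrtD" by blast
    have "h1 * h2 = a * c + b * d * (sqrtD * sqrtD) + (a * d + b * c) * sqrtD"
      by (simp add: * algebra_simps)
    then show ?case
      using * by (intro bexI[of _ "a * c + b * d * of_int D"] bexI[of _ "a * d + b * c"])
        (simp_all add: sqrtD_square)
  qed
next
  assume "\<exists>a\<in>\<rat>. \<exists>b\<in>\<rat>. x = a + b * sqrtD"
  then show "x \<in> K"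
    using K_add K_mult K_Rats K_sqrtD by blast
qed

lemma K_cnj: "x \<in> K \<Longrightarrow> cnj x \<in> K"
  unfolding K_iff
proof (elim bexE)
  fix a b assume "a \<in> \<rat>" "b \<in> \<rat>" "x = a + b * sqrtD"
  then show "\<exists>a\<in>\<rat>. \<exists>b\<in>\<rat>. cnj x = a + b * sqrtD"
    by (intro bexI[of _ a] bexI[of _ "- b"]) (simp_all add: cnj_Rats cnj_sqrtD)
qed

lemma K_trace_Rats: "x \<in> K \<Longrightarrow> x + cnj x \<in> \<rat>"
  unfolding K_iff by (auto simp: cnj_Rats cnj_sqrtD)

lemma K_norm_Rats:
  assumes "x \<in> K"
  shows "x * cnj x \<in> \<rat>"
proof -
  obtain a b where ab: "a \<in> \<rat>" "b \<in> \<rat>" "x = a + b * sqrtD"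
    using assms unfolding K_iff by blast
  have "x * cnj x = a * a - b * b * (sqrtD * sqrtD)"
    using ab by (simp add: cnj_Rats cnj_sqrtD algebra_simps)
  then show ?thesis
    using ab by (simp add: sqrtD_square)
qed

text \<open>
  Clearing denominators in \<open>x\<^sup>2 - (x + cnj x) x + x cnj x = 0\<close> gives the integer polynomial of degree two
  to which Gauss's lemma applies; a real element of \<open>K\<close> is rational, hence a rational integer.
\<close>

lemma trace_norm_Ints:
  assumes "x \<in> \<O>"
  shows "x + cnj x \<in> \<int>" and "x * cnj x \<in> \<int>"
proof -
  have x: "x \<in> K" "algebraic_int x"
    using assms by (simp_all add: \<O>_def)
  show "x + cnj x \<in> \<int>" and "x * cnj x \<in> \<int>"
  proof (atomize (full), cases "x \<in> \<real>")
    case True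
    then have "x + x \<in> \<rat>"
      using K_trace_Rats[OF x(1)] by (simp add: Reals_cnj_iff)
    then have "(x + x) / 2 \<in> \<rat>"
      by (rule Rats_divide) simp
    then have "x \<in> \<int>"
      using rational_algebraic_int_is_int x(2) by simp
    then show "x + cnj x \<in> \<int> \<and> x * cnj x \<in> \<int>"
      using True by (simp add: Reals_cnj_iff)
  next
    case False
    obtain t1 t2 where t: "t2 > 0" "x + cnj x = of_int t1 / of_int t2"
      using K_trace_Rats[OF x(1)] by (auto elim: Rats_cases')
    obtain n1 n2 where n: "n2 > 0" "x * cnj x = of_int n1 / of_int n2"
      using K_norm_Rats[OF x(1)] by (auto elim: Rats_cases')
    have "x * (x * (of_int t2 * of_int n2)) - x * (of_int t1 * of_int n2) + of_int n1 * of_int t2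
        = of_int t2 * of_int n2 * (x * x - x * (of_int t1 / of_int t2) + of_int n1 / of_int n2)"
      using t(1) n(1) by (simp add: field_simps)
    also have "\<dots> = 0"
      by (simp add: t(2)[symmetric] n(2)[symmetric] algebra_simps)
    finally have "poly (map_poly of_int [: n1 * t2, - t1 * n2, t2 * n2 :]) x = 0"
      using t(1) n(1) by (simp add: map_poly_pCons algebra_simps)
    moreover have "[: n1 * t2, - t1 * n2, t2 * n2 :] \<noteq> 0"
      using t(1) n(1) by simp
    ultimately show "x + cnj x \<in> \<int> \<and> x * cnj x \<in> \<int>"
      using quadratic_algebraic_int_trace_norm[OF x(2) False, of "[: n1 * t2, - t1 * n2, t2 * n2 :]"]
      by simp
  qed
qed

lemma \<O>_iff: "x \<in> \<O> \<longleftrightarrow> x \<in> K \<and> x + cnj x \<in> \<int> \<and> x * cnj x \<in> \<int>"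
  using trace_norm_Ints algebraic_int_if_trace_norm_Ints by (auto simp: \<O>_def)

lemma \<O>_K: "x \<in> \<O> \<Longrightarrow> x \<in> K"
  by (simp add: \<O>_def)

lemma \<O>_Ints: "x \<in> \<int> \<Longrightarrow> x \<in> \<O>"
  by (metis Ints_cases K_of_int \<O>_def int_imp_algebraic_int mem_Collect_eq)

lemma \<O>_of_int: "of_int n \<in> \<O>"
  by (simp add: \<O>_Ints)

lemma \<O>_0: "0 \<in> \<O>" and \<O>_1: "1 \<in> \<O>"
  by (simp_all add: \<O>_Ints)

lemma \<O>_Rats: "x \<in> \<O> \<Longrightarrow> x \<in> \<rat> \<Longrightarrow> x \<in> \<int>"
  by (simp add: \<O>_def rational_algebraic_int_is_int)

lemma \<O>_uminus: "x \<in> \<O> \<Longrightarrow> - x \<in> \<O>"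
  by (simp add: \<O>_def K_uminus)

lemma \<O>_cnj: "x \<in> \<O> \<Longrightarrow> cnj x \<in> \<O>"
  by (simp add: \<O>_def K_cnj)

lemma \<O>_sqrtD: "sqrtD \<in> \<O>"
  unfolding \<O>_def sqrtD_def using K_sqrtD[unfolded sqrtD_def] algebraic_int_csqrt int_imp_algebraic_int
  by blast

text \<open>
  The key to the closure of \<open>\<O>\<close> under addition and multiplication. The rational number
  \<open>s = Tr (x y)\<close> and its companion \<open>Tr (x cnj y)\<close> have the sum \<open>Tr x * Tr y\<close> and a product that is an
  integer polynomial in the traces and norms of \<open>x\<close> and \<open>y\<close>. So \<open>s\<close> is a root of a monic integer
  quadratic polynomial.
\<close>

lemma trace_mult_Ints:
  assumes x: "x \<in> \<O>" and y: "y \<in> \<O>"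
  shows "x * y + cnj (x * y) \<in> \<int>"
proof -
  define s where "s = x * y + cnj (x * y)"
  have Rats: "s \<in> \<rat>"
    using K_trace_Rats[OF K_mult] x y by (simp add: s_def \<O>_K)
  \<comment> \<open>With \<open>s'\<close> the trace of \<open>x cnj y\<close>: \<open>T = s + s'\<close> and \<open>N = s s'\<close>.\<close>
  define T where "T = (x + cnj x) * (y + cnj y)"
  define N where "N = ((x + cnj x)^2 - 2 * (x * cnj x)) * (y * cnj y)
      + ((y + cnj y)^2 - 2 * (y * cnj y)) * (x * cnj x)"
  have "T \<in> \<int>" "N \<in> \<int>"
    using trace_norm_Ints[OF x] trace_norm_Ints[OF y] by (simp_all add: T_def N_def)
  have "s * (T - s) = N"
    by (simp add: s_def T_def N_def algebra_simps power2_eq_square)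
  then have "poly [:N, - T, 1:] s = 0"
    by (simp add: algebra_simps flip: \<open>s * (T - s) = N\<close>)
  moreover have "\<forall>i. Polynomial.coeff [:N, - T, 1:] i \<in> \<int>"
    using \<open>T \<in> \<int>\<close> \<open>N \<in> \<int>\<close> by (auto simp: coeff_pCons split: nat.splits)
  ultimately have "algebraic_int s"
    using algebraic_int.intros[of "[:N, - T, 1:]" s] by simp
  then show ?thesis
    using Rats rational_algebraic_int_is_int by (simp add: s_def)
qed

lemma \<O>_add:
  assumes x: "x \<in> \<O>" and y: "y \<in> \<O>"
  shows "x + y \<in> \<O>"
proof -
  have "(x + y) + cnj (x + y) = (x + cnj x) + (y + cnj y)"
    by simp
  moreover have "(x + y) * cnj (x + y)
      = x * cnj x + y * cnj y + (x * cnj y + cnj (x * cnj y))"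
    by (simp add: algebra_simps)
  ultimately show ?thesis
    using trace_norm_Ints[OF x] trace_norm_Ints[OF y] trace_mult_Ints[OF x \<O>_cnj[OF y]]
      K_add[OF \<O>_K \<O>_K, OF x y] unfolding \<O>_iff[of "x + y"] by (simp only: Ints_add)
qed

lemma \<O>_mult:
  assumes x: "x \<in> \<O>" and y: "y \<in> \<O>"
  shows "x * y \<in> \<O>"
proof -
  have "(x * y) * cnj (x * y) = (x * cnj x) * (y * cnj y)"
    by simp
  then show ?thesis
    using trace_norm_Ints[OF x] trace_norm_Ints[OF y] trace_mult_Ints[OF x y]
      K_mult[OF \<O>_K \<O>_K, OF x y] unfolding \<O>_iff[of "x * y"] by (simp only: Ints_mult)
qed

lemma \<O>_diff: "x \<in> \<O> \<Longrightarrow> y \<in> \<O> \<Longrightarrow> x - y \<in> \<O>"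
  using \<O>_add[OF _ \<O>_uminus, of x y] by simp

lemma \<O>_power: "x \<in> \<O> \<Longrightarrow> x ^ n \<in> \<O>"
  by (induction n) (simp_all add: \<O>_1 \<O>_mult)

lemma integral_multiple:
  assumes "x \<in> K"
  obtains n :: int where "n > 0" and "of_int n * x \<in> \<O>"
proof -
  obtain a b where ab: "a \<in> \<rat>" "b \<in> \<rat>" "x = a + b * sqrtD"
    using assms unfolding K_iff by blast
  obtain a1 a2 b1 b2 :: int where *: "a2 > 0" "a = of_int a1 / of_int a2" "b2 > 0" "b = of_int b1 / of_int b2"
    using ab(1,2) by (auto elim!: Rats_cases')
  have "of_int (a2 * b2) * x = of_int (a1 * b2) + of_int (b1 * a2) * sqrtD"
  proof -
    have "of_int (a2 * b2) * x = (of_int a2 * a) * of_int b2 + (of_int b2 * b) * of_int a2 * sqrtD"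
      unfolding ab(3) by (simp add: algebra_simps)
    moreover have "of_int a2 * a = of_int a1" "of_int b2 * b = of_int b1"
      using *(1,3) unfolding *(2,4) by simp_all
    ultimately show ?thesis
      by simp
  qed
  then show thesis
    using that[of "a2 * b2"] *(1,3) by (simp only: \<O>_add \<O>_mult \<O>_of_int \<O>_sqrtD mult_pos_pos)
qed

end

section \<open>The group of fractional ideals\<close>

abbreviation ideal_star :: "complex set \<Rightarrow> complex set \<Rightarrow> complex set" (infixl \<open>\<star>\<close> 70)
  where "I \<star> J \<equiv> ideal_prod complex_ring I J"

lemma star_multI: "x \<in> I \<Longrightarrow> y \<in> J \<Longrightarrow> x * y \<in> I \<star> J"
  using ideal_prod.prod[of x I y J complex_ring] by simp

lemma star_addI: "x \<in> I \<star> J \<Longrightarrow> y \<in> I \<star> J \<Longrightarrow> x + y \<in> I \<star> J"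
  using ideal_prod.sum[of x complex_ring I J y] by simp

lemma star_induct [consumes 1, case_names mult add]:
  assumes "s \<in> I \<star> J"
    and "\<And>x y. x \<in> I \<Longrightarrow> y \<in> J \<Longrightarrow> P (x * y)"
    and "\<And>s t. P s \<Longrightarrow> P t \<Longrightarrow> P (s + t)"
  shows "P s"
  using assms(1) by (induction rule: ideal_prod.induct) (simp_all add: assms(2,3))

lemma star_subsetI:
  assumes "\<And>x y. x \<in> I \<Longrightarrow> y \<in> J \<Longrightarrow> x * y \<in> L"
    and "\<And>s t. s \<in> L \<Longrightarrow> t \<in> L \<Longrightarrow> s + t \<in> L"
  shows "I \<star> J \<subseteq> L"
proof
  fix s assume "s \<in> I \<star> J"
  then show "s \<in> L"
    by (induction rule: star_induct) (rule assms; assumption)+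
qed

lemma star_commute: "I \<star> J = J \<star> I"
  by (intro equalityI star_subsetI) (metis star_multI mult.commute star_addI)+

lemma star_assoc: "(I \<star> J) \<star> L = I \<star> (J \<star> L)"
proof (rule equalityI)
  have *: "(I \<star> J) \<star> L \<subseteq> I \<star> (J \<star> L)" for I J L
  proof (rule star_subsetI)
    fix s l assume "s \<in> I \<star> J" "l \<in> L"
    then show "s * l \<in> I \<star> (J \<star> L)"
      by (induction rule: star_induct)
        (simp_all add: star_multI star_addI distrib_right mult.assoc)
  qed (rule star_addI)
  show "(I \<star> J) \<star> L \<subseteq> I \<star> (J \<star> L)" by (rule *)
  show "I \<star> (J \<star> L) \<subseteq> (I \<star> J) \<star> L"
    using *[of L J I] by (metis star_commute)
qed

context imaginary_quadratic
begin

lemma ring_of_integers_simps: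
  "carrier (ring_of_integers K) = \<O>"
  "x \<otimes>\<^bsub>ring_of_integers K\<^esub> y = x * y"
  "x \<oplus>\<^bsub>ring_of_integers K\<^esub> y = x + y"
  "\<zero>\<^bsub>ring_of_integers K\<^esub> = 0"
  by (simp_all add: ring_of_integers_def \<O>_def)

lemma ring_ring_of_integers: "ring (ring_of_integers K)"
proof -
  have "subring \<O> complex_ring"
    by (rule complex_ring.subringI) (simp_all add: \<O>_1 \<O>_uminus \<O>_mult \<O>_add)
  then show ?thesis
    using complex_ring.subring_is_ring unfolding ring_of_integers_def \<O>_def by blast
qed

text \<open>
  The closure conditions that ideals and fractional ideals share, apart from their conditions on size.
  Negatives are covered because \<open>- 1\<close> is an element of \<open>\<O>\<close>.
\<close>

definition integral_module :: "complex set \<Rightarrow> bool" where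
  "integral_module J \<longleftrightarrow> 0 \<in> J \<and> (\<forall>x\<in>J. \<forall>y\<in>J. x + y \<in> J) \<and> (\<forall>a\<in>\<O>. \<forall>x\<in>J. a * x \<in> J)"

lemma integral_moduleI:
  assumes "0 \<in> J" and "\<And>x y. x \<in> J \<Longrightarrow> y \<in> J \<Longrightarrow> x + y \<in> J"
    and "\<And>a x. a \<in> \<O> \<Longrightarrow> x \<in> J \<Longrightarrow> a * x \<in> J"
  shows "integral_module J"
  using assms by (simp add: integral_module_def)

lemma integral_moduleD:
  assumes "integral_module J"
  shows "0 \<in> J" and "x \<in> J \<Longrightarrow> y \<in> J \<Longrightarrow> x + y \<in> J" and "a \<in> \<O> \<Longrightarrow> x \<in> J \<Longrightarrow> a * x \<in> J"
  using assms by (simp_all add: integral_module_def)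

lemma integral_module_scaled_iff:
  assumes "c \<noteq> 0"
  shows "integral_module ((*) c ` I) \<longleftrightarrow> integral_module I"
proof -
  have mem: "c * x \<in> (*) c ` I \<longleftrightarrow> x \<in> I" for x
    using assms by auto
  have "a * (c * x) \<in> (*) c ` I \<longleftrightarrow> a * x \<in> I" for a x
    using mem[of "a * x"] by (simp add: mult.left_commute)
  moreover have "c * x + c * y \<in> (*) c ` I \<longleftrightarrow> x + y \<in> I" for x y
    using mem[of "x + y"] by (simp add: distrib_left)
  moreover have "0 \<in> (*) c ` I \<longleftrightarrow> 0 \<in> I"
    using mem[of 0] by simp
  ultimately show ?thesis
    unfolding integral_module_def by (simp only: ball_simps)
qed

lemma ideal_ring_of_integers_iff:
  "ideal J (ring_of_integers K) \<longleftrightarrow> J \<subseteq> \<O> \<and> integral_module J"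
proof
  assume "ideal J (ring_of_integers K)"
  then interpret I: ideal J "ring_of_integers K" .
  have "integral_module J"
    using additive_subgroup.zero_closed[OF I.additive_subgroup_axioms]
      additive_subgroup.a_closed[OF I.additive_subgroup_axioms] I.I_l_closed
    by (intro integral_moduleI) (simp_all add: ring_of_integers_simps)
  then show "J \<subseteq> \<O> \<and> integral_module J"
    using I.a_subset by (simp add: ring_of_integers_simps)
next
  interpret R: ring "ring_of_integers K" by (rule ring_ring_of_integers)
  assume J: "J \<subseteq> \<O> \<and> integral_module J"
  note J = conjunct1[OF J] integral_moduleD[OF conjunct2[OF J]]
  have a_inv: "\<ominus>\<^bsub>ring_of_integers K\<^esub> x = - x" if "x \<in> \<O>" for x
    using R.minus_equality[of "- x" x] that by (simp add: ring_of_integers_simps \<O>_uminus)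
  show "ideal J (ring_of_integers K)"
  proof (rule idealI[OF ring_ring_of_integers])
    show "subgroup J (add_monoid (ring_of_integers K))"
    proof
      fix x assume "x \<in> J"
      then have "x \<in> \<O>" "- x \<in> J"
        using J(1) J(4)[of "- 1" x] \<O>_of_int[of "- 1"] by auto
      then show "inv\<^bsub>add_monoid (ring_of_integers K)\<^esub> x \<in> J"
        using a_inv[of x] by (simp add: a_inv_def)
    qed (use J in \<open>auto simp: ring_of_integers_simps\<close>)
  next
    fix a x assume "a \<in> J" "x \<in> carrier (ring_of_integers K)"
    then have "x * a \<in> J"
      by (intro J(4)) (simp_all add: ring_of_integers_simps)
    then show "x \<otimes>\<^bsub>ring_of_integers K\<^esub> a \<in> J" and "a \<otimes>\<^bsub>ring_of_integers K\<^esub> x \<in> J"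
      by (simp_all add: ring_of_integers_simps mult.commute)
  qed
qed

lemma fractional_ideals_iff:
  "I \<in> fractional_ideals K \<longleftrightarrow>
    I \<subseteq> K \<and> I \<noteq> {0} \<and> integral_module I \<and> (\<exists>c\<in>\<O>. c \<noteq> 0 \<and> (*) c ` I \<subseteq> \<O>)"
  unfolding fractional_ideals_def ring_of_integers_simps ideal_ring_of_integers_iff
  using integral_module_scaled_iff by auto

lemma fractional_idealI:
  assumes "I \<subseteq> K" and "x \<in> I" "x \<noteq> 0" and "integral_module I"
    and "c \<in> \<O>" "c \<noteq> 0" "\<And>x. x \<in> I \<Longrightarrow> c * x \<in> \<O>"
  shows "I \<in> fractional_ideals K"
  unfolding fractional_ideals_iff
proof (intro conjI)
  show "\<exists>c\<in>\<O>. c \<noteq> 0 \<and> (*) c ` I \<subseteq> \<O>"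
    using assms(5-7) by (intro bexI[of _ c]) auto
qed (use assms(1-4) in auto)

lemma fractional_ideal_subset: "I \<in> fractional_ideals K \<Longrightarrow> I \<subseteq> K"
  by (simp add: fractional_ideals_iff)

lemma fractional_ideal_module:
  assumes "I \<in> fractional_ideals K"
  shows "0 \<in> I" and "x \<in> I \<Longrightarrow> y \<in> I \<Longrightarrow> x + y \<in> I" and "a \<in> \<O> \<Longrightarrow> x \<in> I \<Longrightarrow> a * x \<in> I"
  using integral_moduleD[of I] assms by (simp_all add: fractional_ideals_iff)

lemma fractional_ideal_nonzero:
  assumes "I \<in> fractional_ideals K"
  obtains x where "x \<in> I" "x \<noteq> 0"
  using assms integral_moduleD(1)[of I] by (auto simp: fractional_ideals_iff)

lemma fractional_ideal_denominator:
  assumes "I \<in> fractional_ideals K"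
  obtains c where "c \<in> \<O>" "c \<noteq> 0" "\<And>x. x \<in> I \<Longrightarrow> c * x \<in> \<O>"
  using assms by (auto simp: fractional_ideals_iff)

abbreviation principal :: "complex \<Rightarrow> complex set" where "principal x \<equiv> (*) x ` \<O>"

lemma fractional_ideal_star:
  assumes I: "I \<in> fractional_ideals K" and J: "J \<in> fractional_ideals K"
  shows "I \<star> J \<in> fractional_ideals K"
proof -
  obtain x where x: "x \<in> I" "x \<noteq> 0" by (rule fractional_ideal_nonzero[OF I])
  obtain y where y: "y \<in> J" "y \<noteq> 0" by (rule fractional_ideal_nonzero[OF J])
  obtain c where c: "c \<in> \<O>" "c \<noteq> 0" "\<And>x. x \<in> I \<Longrightarrow> c * x \<in> \<O>"
    using fractional_ideal_denominator[OF I] by blast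
  obtain d where d: "d \<in> \<O>" "d \<noteq> 0" "\<And>x. x \<in> J \<Longrightarrow> d * x \<in> \<O>"
    using fractional_ideal_denominator[OF J] by blast
  show ?thesis
  proof (rule fractional_idealI[of _ "x * y" "c * d"])
    show "I \<star> J \<subseteq> K"
      using fractional_ideal_subset[OF I] fractional_ideal_subset[OF J]
      by (intro star_subsetI) (auto intro: K_mult K_add)
    show "integral_module (I \<star> J)"
    proof (rule integral_moduleI)
      show "0 \<in> I \<star> J"
        using star_multI[OF fractional_ideal_module(1)[OF I] fractional_ideal_module(1)[OF J]] by simp
      show "a * s \<in> I \<star> J" if "a \<in> \<O>" "s \<in> I \<star> J" for a s
        using that(2)
      proof (induction rule: star_induct)
        case (mult x y)
        then show ?case
          using star_multI[OF fractional_ideal_module(3)[OF I \<open>a \<in> \<O>\<close>]] by (simp flip: mult.assoc)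
      qed (simp add: distrib_left star_addI)
    qed (rule star_addI)
    show "c * d * s \<in> \<O>" if "s \<in> I \<star> J" for s
      using that
    proof (induction rule: star_induct)
      case (mult x y)
      then have "(c * x) * (d * y) \<in> \<O>"
        by (intro \<O>_mult c(3) d(3))
      then show ?case by (simp add: mult_ac)
    qed (simp add: distrib_left \<O>_add)
  qed (use x y c d in \<open>simp_all add: star_multI \<O>_mult\<close>)
qed

lemma \<O>_fractional: "\<O> \<in> fractional_ideals K"
  by (rule fractional_idealI[of _ 1 1])
    (auto intro!: integral_moduleI simp: \<O>_K \<O>_0 \<O>_1 \<O>_add \<O>_mult)

lemma scaled_fractional:
  assumes I: "I \<in> fractional_ideals K" and "z \<in> K" "z \<noteq> 0"
  shows "(*) z ` I \<in> fractional_ideals K"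
proof -
  obtain x where x: "x \<in> I" "x \<noteq> 0" by (rule fractional_ideal_nonzero[OF I])
  obtain c where c: "c \<in> \<O>" "c \<noteq> 0" "\<And>x. x \<in> I \<Longrightarrow> c * x \<in> \<O>"
    using fractional_ideal_denominator[OF I] by blast
  obtain e :: int where e: "e > 0" "of_int e * z \<in> \<O>"
    by (rule integral_multiple[OF \<open>z \<in> K\<close>])
  show ?thesis
  proof (rule fractional_idealI[of _ "z * x" "c * of_int e"])
    show "(*) z ` I \<subseteq> K"
      using fractional_ideal_subset[OF I] assms(2) by (auto intro: K_mult)
    show "integral_module ((*) z ` I)"
      using I \<open>z \<noteq> 0\<close> by (simp add: integral_module_scaled_iff fractional_ideals_iff)
    show "c * of_int e * y \<in> \<O>" if y: "y \<in> (*) z ` I" for y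
    proof -
      obtain x where "x \<in> I" "y = z * x" using y by blast
      then have "c * of_int e * y = (of_int e * z) * (c * x)" by simp
      then show ?thesis
        using \<O>_mult[OF e(2) c(3)[OF \<open>x \<in> I\<close>]] by (simp only:)
    qed
  qed (use x c e \<open>z \<noteq> 0\<close> in \<open>simp_all add: \<O>_mult \<O>_of_int\<close>)
qed

lemma cnj_fractional:
  assumes I: "I \<in> fractional_ideals K"
  shows "cnj ` I \<in> fractional_ideals K"
proof -
  obtain x where x: "x \<in> I" "x \<noteq> 0" by (rule fractional_ideal_nonzero[OF I])
  obtain c where c: "c \<in> \<O>" "c \<noteq> 0" "\<And>x. x \<in> I \<Longrightarrow> c * x \<in> \<O>"
    using fractional_ideal_denominator[OF I] by blast
  show ?thesis
  proof (rule fractional_idealI[of _ "cnj x" "cnj c"])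
    show "cnj ` I \<subseteq> K"
      using fractional_ideal_subset[OF I] by (auto intro: K_cnj)
    show "integral_module (cnj ` I)"
    proof (rule integral_moduleI)
      show "0 \<in> cnj ` I"
        using imageI[OF fractional_ideal_module(1)[OF I], of cnj] by simp
      show "x + y \<in> cnj ` I" if "x \<in> cnj ` I" "y \<in> cnj ` I" for x y
        using that fractional_ideal_module(2)[OF I] by (auto simp flip: complex_cnj_add)
      fix a y assume a: "a \<in> \<O>" and "y \<in> cnj ` I"
      then obtain x where "x \<in> I" "y = cnj x" by blast
      then have "a * y = cnj (cnj a * x)" "cnj a * x \<in> I"
        using fractional_ideal_module(3)[OF I \<O>_cnj[OF a]] by simp_all
      then show "a * y \<in> cnj ` I" by (simp only: imageI)
    qed
    show "cnj c * y \<in> \<O>" if y: "y \<in> cnj ` I" for y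
    proof -
      obtain x where "x \<in> I" "y = cnj x" using y by blast
      then show ?thesis
        using \<O>_cnj[OF c(3)[OF \<open>x \<in> I\<close>]] by simp
    qed
  qed (use x c in \<open>simp_all add: \<O>_cnj\<close>)
qed

lemma principal_star:
  assumes I: "I \<in> fractional_ideals K"
  shows "principal x \<star> I = (*) x ` I"
proof
  show "principal x \<star> I \<subseteq> (*) x ` I"
    using fractional_ideal_module(2,3)[OF I]
    by (intro star_subsetI) (auto simp: mult.assoc simp flip: distrib_left)
  show "(*) x ` I \<subseteq> principal x \<star> I"
  proof
    fix s assume "s \<in> (*) x ` I"
    then obtain i where "i \<in> I" "s = (x * 1) * i" by auto
    then show "s \<in> principal x \<star> I"
      using star_multI[of "x * 1" "principal x" i I] \<O>_1 by blast
  qed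
qed

lemma \<O>_star: "I \<in> fractional_ideals K \<Longrightarrow> \<O> \<star> I = I"
  using principal_star[of I 1] by simp

lemma principal_fractional: "x \<in> K \<Longrightarrow> x \<noteq> 0 \<Longrightarrow> principal x \<in> fractional_ideals K"
  by (rule scaled_fractional[OF \<O>_fractional])

lemma principal_star_principal:
  assumes "y \<in> K" "y \<noteq> 0"
  shows "principal x \<star> principal y = principal (x * y)"
  using principal_star[OF principal_fractional[OF assms]] by (simp add: image_image mult.assoc)

text \<open>
  The rational integers in \<open>I \<star> cnj ` I\<close> are the multiples of a positive \<open>g\<close>. For \<open>x\<close> and \<open>y\<close> in
  \<open>I\<close> the integers \<open>Tr (x cnj y)\<close>, \<open>N x\<close> and \<open>N y\<close> lie in this set, so \<open>x cnj y / g\<close> has integral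
  trace and norm and is an algebraic integer. Hence \<open>g\<close> generates the whole product.
\<close>

lemma integral_star_cnj_principal:
  assumes I: "I \<in> fractional_ideals K" and "I \<subseteq> \<O>"
  obtains g :: int where "g > 0" and "I \<star> (cnj ` I) = principal (of_int g)"
proof -
  have S: "I \<star> (cnj ` I) \<in> fractional_ideals K" (is "?S \<in> _")
    by (intro fractional_ideal_star I cnj_fractional)
  define Z where "Z = {n :: int. of_int n \<in> ?S}"
  have norm_Z: "\<exists>n\<in>Z. x * cnj x = of_int n" if "x \<in> I" for x
  proof -
    have "x * cnj x \<in> \<int>"
      using trace_norm_Ints(2) that \<open>I \<subseteq> \<O>\<close> by blast
    then obtain n where n: "x * cnj x = of_int n"
      by (elim Ints_cases)
    moreover have "x * cnj x \<in> ?S"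
      using that by (intro star_multI imageI)
    ultimately show ?thesis
      by (auto simp: Z_def)
  qed
  have Z_lin: "a * m + b * n \<in> Z" if "m \<in> Z" "n \<in> Z" for a b m n
    using fractional_ideal_module(2)[OF S fractional_ideal_module(3)[OF S \<O>_of_int] fractional_ideal_module(3)[OF S \<O>_of_int]]
      that by (simp add: Z_def)
  obtain x0 where x0: "x0 \<in> I" "x0 \<noteq> 0"
    by (rule fractional_ideal_nonzero[OF I])
  have "\<exists>n\<in>Z. n > 0"
  proof -
    obtain n where n: "n \<in> Z" "x0 * cnj x0 = of_int n"
      using norm_Z[OF x0(1)] by blast
    have "n \<noteq> 0" using n(2) x0(2) by (metis complex_cnj_zero_iff mult_eq_0_iff of_int_0)
    then show ?thesis
      using n(1) Z_lin[OF n(1) n(1), of "- 1" 0]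
      by (intro bexI[of _ "\<bar>n\<bar>"]) (auto simp: abs_if)
  qed
  \<comment> \<open>The least positive element of \<open>Z\<close> generates it.\<close>
  define k where "k = (LEAST k. k > 0 \<and> int k \<in> Z)"
  have ex: "\<exists>k. k > 0 \<and> int k \<in> Z"
    using \<open>\<exists>n\<in>Z. n > 0\<close> by (metis pos_int_cases)
  have k: "k > 0" "int k \<in> Z"
    using LeastI_ex[OF ex] by (simp_all add: k_def)
  define g where "g = int k"
  have g: "g > 0" "g \<in> Z" using k by (simp_all add: g_def)
  have dvd: "g dvd n" if "n \<in> Z" for n
  proof (rule ccontr)
    assume "\<not> g dvd n"
    have "n mod g = 1 * n + (- (n div g)) * g"
      by (simp add: minus_div_mult_eq_mod)
    then have "n mod g \<in> Z"
      using Z_lin[OF that g(2)] by metis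
    moreover have "0 < n mod g" "n mod g < g"
      using \<open>\<not> g dvd n\<close> g(1) by (simp_all add: dvd_eq_mod_eq_0 order_le_neq_trans)
    ultimately have "nat (n mod g) < k" "nat (n mod g) > 0 \<and> int (nat (n mod g)) \<in> Z"
      by (simp_all add: g_def)
    then show False
      using not_less_Least k_def by blast
  qed
  have "?S \<subseteq> principal (of_int g)"
  proof (rule star_subsetI)
    fix x y' assume "x \<in> I" "y' \<in> cnj ` I"
    then obtain y where y: "y \<in> I" "y' = cnj y" by blast
    have xO: "x \<in> \<O>" and yO: "y \<in> \<O>" using \<open>x \<in> I\<close> y \<open>I \<subseteq> \<O>\<close> by auto
    define w where "w = x * cnj y / of_int g"
    have "x * cnj y + y * cnj x \<in> ?S"
      using \<open>x \<in> I\<close> y(1) by (intro star_addI star_multI) auto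
    moreover have "x * cnj y + cnj (x * cnj y) \<in> \<int>"
      by (intro trace_mult_Ints xO \<O>_cnj yO)
    ultimately obtain t where t: "t \<in> Z" "x * cnj y + y * cnj x = of_int t"
      by (auto simp: Z_def mult.commute elim!: Ints_cases)
    obtain m n where m: "m \<in> Z" "x * cnj x = of_int m" and n: "n \<in> Z" "y * cnj y = of_int n"
      using norm_Z \<open>x \<in> I\<close> y(1) by meson
    obtain t' m' n' where tmn: "t = g * t'" "m = g * m'" "n = g * n'"
      using dvd[OF t(1)] dvd[OF m(1)] dvd[OF n(1)] by (auto elim!: dvdE)
    have "w + cnj w = (x * cnj y + y * cnj x) / of_int g"
      by (simp add: w_def add_divide_distrib mult.commute)
    also have "\<dots> = of_int t'"
      using g(1) by (simp add: t(2) tmn)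
    finally have "w + cnj w \<in> \<int>" by simp
    moreover have "w * cnj w = (x * cnj x) * (y * cnj y) / (of_int g * of_int g)"
      by (simp add: w_def)
    then have "w * cnj w = of_int (m' * n')"
      using g(1) by (simp add: m(2) n(2) tmn)
    then have "w * cnj w \<in> \<int>" by (metis Ints_of_int)
    moreover have "w \<in> K"
      unfolding w_def divide_inverse using xO yO
      by (intro K_mult K_inverse K_of_int) (simp_all add: \<O>_K K_cnj)
    ultimately have "w \<in> \<O>" by (simp add: \<O>_iff)
    then show "x * y' \<in> principal (of_int g)"
      using g(1) y(2) by (intro image_eqI[of _ _ w]) (simp_all add: w_def)
  qed (auto simp: \<O>_add simp flip: distrib_left)
  moreover have "principal (of_int g) \<subseteq> ?S"
    using g(2) fractional_ideal_module(3)[OF S, of _ "of_int g"] by (auto simp: Z_def mult.commute)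
  ultimately show thesis
    using that g(1) by blast
qed

lemma fractional_ideal_invertible:
  assumes I: "I \<in> fractional_ideals K"
  obtains J where "J \<in> fractional_ideals K" and "J \<star> I = \<O>"
proof -
  obtain c where c: "c \<in> \<O>" "c \<noteq> 0" "\<And>x. x \<in> I \<Longrightarrow> c * x \<in> \<O>"
    using fractional_ideal_denominator[OF I] by blast
  let ?I = "principal c \<star> I"
  have I': "?I \<in> fractional_ideals K"
    using fractional_ideal_star[OF principal_fractional I] c \<O>_K by blast
  have "?I \<subseteq> \<O>"
    using c(3) by (auto simp: principal_star[OF I])
  then obtain g :: int where g: "g > 0" "?I \<star> (cnj ` ?I) = principal (of_int g)"
    using integral_star_cnj_principal[OF I'] by blast
  have P: "principal c \<in> fractional_ideals K" "principal (inverse (of_int g)) \<in> fractional_ideals K"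
    using c g \<O>_K K_inverse K_of_int by (auto intro!: principal_fractional)
  let ?J = "principal (inverse (of_int g)) \<star> (principal c \<star> cnj ` ?I)"
  have "?J \<star> I = principal (inverse (of_int g)) \<star> (?I \<star> cnj ` ?I)"
    by (metis star_assoc star_commute)
  also have "\<dots> = principal (inverse (of_int g) * of_int g)"
    unfolding g(2) using g(1) K_of_int by (intro principal_star_principal) simp_all
  also have "\<dots> = \<O>"
    using g(1) by simp
  finally show thesis
    using that P I' by (meson cnj_fractional fractional_ideal_star)
qed

abbreviation \<I> :: "complex set monoid" where "\<I> \<equiv> fractional_ideal_group K"

lemma fractional_ideal_group_simps [simp]:
  "carrier \<I> = fractional_ideals K" "I \<otimes>\<^bsub>\<I>\<^esub> J = I \<star> J" "\<one>\<^bsub>\<I>\<^esub> = \<O>"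
  by (simp_all add: fractional_ideal_group_def ring_of_integers_simps)

lemma comm_group_fractional_ideals: "comm_group \<I>"
proof (rule comm_groupI; unfold fractional_ideal_group_simps)
  show "I \<star> J \<in> fractional_ideals K" if "I \<in> fractional_ideals K" "J \<in> fractional_ideals K" for I J
    by (rule fractional_ideal_star[OF that])
  show "\<O> \<in> fractional_ideals K" by (rule \<O>_fractional)
  show "I \<star> J \<star> L = I \<star> (J \<star> L)" for I J L by (rule star_assoc)
  show "I \<star> J = J \<star> I" for I J by (rule star_commute)
  show "\<O> \<star> I = I" if "I \<in> fractional_ideals K" for I by (rule \<O>_star[OF that])
  show "\<exists>J\<in>fractional_ideals K. J \<star> I = \<O>" if "I \<in> fractional_ideals K" for I
    using fractional_ideal_invertible[OF that] by metis
qed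

interpretation \<I>: comm_group \<I>
  by (rule comm_group_fractional_ideals)

abbreviation \<P> :: "complex set set" where "\<P> \<equiv> principal_fractional_ideals K"

lemma principal_iff: "I \<in> \<P> \<longleftrightarrow> (\<exists>x\<in>K. x \<noteq> 0 \<and> I = principal x)"
  by (auto simp: principal_fractional_ideals_def ring_of_integers_simps)

lemma principal_in: "x \<in> K \<Longrightarrow> x \<noteq> 0 \<Longrightarrow> principal x \<in> \<P>"
  using principal_iff by blast

lemma subgroup_principal: "subgroup \<P> \<I>"
proof (rule \<I>.subgroupI)
  show "\<P> \<subseteq> carrier \<I>"
    by (auto simp: principal_iff principal_fractional)
  show "\<P> \<noteq> {}"
    using principal_in[OF K_one] by auto
  fix I J assume "I \<in> \<P>" and "J \<in> \<P>"
  then obtain x y where x: "x \<in> K" "x \<noteq> 0" "I = principal x"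
    and y: "y \<in> K" "y \<noteq> 0" "J = principal y"
    unfolding principal_iff by (elim bexE conjE) metis
  show "I \<otimes>\<^bsub>\<I>\<^esub> J \<in> \<P>"
    using principal_in[OF K_mult[OF x(1) y(1)]] x(2) y(2)
    by (simp add: x(3) y(3) principal_star_principal[OF y(1,2)])
  have "principal (inverse x) \<star> principal x = principal 1"
    using principal_star_principal[OF x(1,2), of "inverse x"] x(2) by simp
  then have "inv\<^bsub>\<I>\<^esub> I = principal (inverse x)"
    using x K_inverse[OF x(1)] principal_fractional by (intro \<I>.inv_equality) simp_all
  then show "inv\<^bsub>\<I>\<^esub> I \<in> \<P>"
    using principal_in[OF K_inverse[OF x(1)]] x(2) by simp
qed

interpretation \<P>: normal \<P> \<I>
  by (rule \<I>.subgroup_imp_normal[OF subgroup_principal])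

section \<open>Finiteness of the class group\<close>



text \<open>
  Hurwitz's substitute for division with remainder: some multiple \<open>t y\<close> with bounded \<open>t\<close> is closer than
  \<open>1\<close> to an integer of \<open>K\<close>. Dirichlet's theorem brings both coordinates of \<open>t y\<close> with respect to
  \<open>1\<close> and \<open>sqrtD\<close> within \<open>1 / N\<close> of integers at the same time.
\<close>

lemma integral_approximation:
  obtains M :: nat where "\<And>y. y \<in> K \<Longrightarrow>
    \<exists>t::int. 0 < t \<and> t \<le> int M \<and> (\<exists>w\<in>\<O>. cmod (of_int t * y - w) < 1)"
proof -
  obtain N :: nat where N: "real N \<ge> 1 + cmod sqrtD"
    using real_arch_simple by blast
  have "real N > 0"
    using N norm_ge_zero[of sqrtD] by linarith
  have "\<exists>t::int. 0 < t \<and> t \<le> int (N ^ 2) \<and> (\<exists>w\<in>\<O>. cmod (of_int t * y - w) < 1)"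
    if y: "y \<in> K" for y
  proof -
    obtain a b where ab: "a \<in> \<rat>" "b \<in> \<rat>" "y = a + b * sqrtD"
      using y unfolding K_iff by blast
    then have "a \<in> \<real>" "b \<in> \<real>"
      by (auto elim!: Rats_cases')
    then obtain ra rb where r: "a = of_real ra" "b = of_real rb"
      by (auto elim!: Reals_cases)
    define \<theta> where "\<theta> i = (if i = 0 then ra else rb)" for i :: nat
    obtain t p where t: "0 < t" "t \<le> int (N ^ 2)"
      and p: "\<And>i. i < 2 \<Longrightarrow> \<bar>of_int t * \<theta> i - of_int (p i)\<bar> < 1 / real N"
      using Dirichlet_approx_simult[of N 2 \<theta>] \<open>real N > 0\<close> by (metis of_nat_0_less_iff)
    define e0 e1 where "e0 = of_int t * ra - of_int (p 0)" and "e1 = of_int t * rb - of_int (p 1)"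
    have e: "\<bar>e0\<bar> < 1 / real N" "\<bar>e1\<bar> < 1 / real N"
      using p[of 0] p[of 1] by (simp_all add: e0_def e1_def \<theta>_def)
    define w where "w = of_int (p 0) + of_int (p 1) * sqrtD"
    have "w \<in> \<O>"
      by (simp add: w_def \<O>_add \<O>_mult \<O>_of_int \<O>_sqrtD)
    have "of_int t * y - w = of_real e0 + of_real e1 * sqrtD"
      unfolding ab(3) r w_def e0_def e1_def by (simp add: algebra_simps)
    then have "cmod (of_int t * y - w) \<le> \<bar>e0\<bar> + \<bar>e1\<bar> * cmod sqrtD"
      using norm_triangle_ineq[of "of_real e0 :: complex" "of_real e1 * sqrtD"] by (simp add: norm_mult)
    also have "\<dots> \<le> \<bar>e0\<bar> + (1 / real N) * cmod sqrtD"
      using e(2) by (intro add_left_mono mult_right_mono) simp_all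
    also have "\<dots> < 1 / real N + (1 / real N) * cmod sqrtD"
      using e(1) by simp
    also have "\<dots> = (1 + cmod sqrtD) / real N"
      by (simp add: add_divide_distrib)
    also have "\<dots> \<le> 1"
      using N \<open>real N > 0\<close> by simp
    finally show ?thesis
      using t \<open>w \<in> \<O>\<close> by blast
  qed
  then show thesis
    using that by blast
qed

lemma norm_nat:
  assumes "x \<in> \<O>"
  obtains n :: nat where "(cmod x)\<^sup>2 = real n" and "x * cnj x = of_nat n"
proof -
  obtain k :: int where k: "x * cnj x = of_int k"
    using trace_norm_Ints(2)[OF assms] by (elim Ints_cases)
  have "of_real ((cmod x)\<^sup>2) = (of_real (real_of_int k) :: complex)"
    using k complex_norm_square[of x] by simp
  then have eq: "(cmod x)\<^sup>2 = real_of_int k"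
    by (simp only: of_real_eq_iff)
  then have "k \<ge> 0"
    using zero_le_power2[of "cmod x"] by linarith
  then show thesis
    using that[of "nat k"] eq k by simp
qed

lemma exists_min_norm:
  assumes "I \<subseteq> \<O>" and "x0 \<in> I" "x0 \<noteq> 0"
  obtains x where "x \<in> I" "x \<noteq> 0" "\<And>y. y \<in> I \<Longrightarrow> cmod y < cmod x \<Longrightarrow> y = 0"
proof -
  define f where "f x = nat \<lfloor>(cmod x)\<^sup>2\<rfloor>" for x
  have f: "real (f x) = (cmod x)\<^sup>2" if "x \<in> I" for x
    using norm_nat[of x] that assms(1) unfolding f_def by (metis floor_of_nat nat_int subsetD)
  obtain x where x: "x \<in> I \<and> x \<noteq> 0" "\<And>y. y \<in> I \<and> y \<noteq> 0 \<Longrightarrow> f x \<le> f y"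
    using ex_has_least_nat[of "\<lambda>x. x \<in> I \<and> x \<noteq> 0" x0 f] assms(2,3) by blast
  have "y = 0" if "y \<in> I" "cmod y < cmod x" for y
  proof (rule ccontr)
    assume "y \<noteq> 0"
    then have "real (f x) \<le> real (f y)"
      using x(2) that(1) by simp
    then have "(cmod x)\<^sup>2 \<le> (cmod y)\<^sup>2"
      using f that(1) x(1) by simp
    then show False
      using that(2) by (simp add: power2_le_iff_abs_le)
  qed
  then show thesis
    using that x(1) by blast
qed

text \<open>
  Let \<open>x\<close> be a nonzero element of least absolute value in an integral ideal. For any other element
  \<open>y\<close>, a number \<open>t y - w x\<close> with \<open>w\<close> integral and \<open>t \<le> M\<close> lies in the ideal and is smaller than
  \<open>x\<close>, so it vanishes, and \<open>M! y\<close> is a multiple of \<open>x\<close>. Dividing the ideal by \<open>x\<close> and multiplying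
  by \<open>M!\<close> gives an integral ideal that contains \<open>M!\<close>.
\<close>

lemma bounded_representative:
  obtains m :: int where "m > 0" and "\<And>I. I \<in> fractional_ideals K \<Longrightarrow>
    \<exists>x\<in>K. x \<noteq> 0 \<and> (*) x ` I \<subseteq> \<O> \<and> of_int m \<in> (*) x ` I"
proof -
  obtain M where M: "\<And>y. y \<in> K \<Longrightarrow>
    \<exists>t::int. 0 < t \<and> t \<le> int M \<and> (\<exists>w\<in>\<O>. cmod (of_int t * y - w) < 1)"
    using integral_approximation by metis
  define m :: int where "m = fact M"
  have "m > 0" by (simp add: m_def)
  have "\<exists>x\<in>K. x \<noteq> 0 \<and> (*) x ` I \<subseteq> \<O> \<and> of_int m \<in> (*) x ` I" if I: "I \<in> fractional_ideals K" for I
  proof -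
    obtain c where c: "c \<in> \<O>" "c \<noteq> 0" "\<And>x. x \<in> I \<Longrightarrow> c * x \<in> \<O>"
      using fractional_ideal_denominator[OF I] by blast
    define I' where "I' = (*) c ` I"
    have I': "I' \<in> fractional_ideals K"
      unfolding I'_def by (rule scaled_fractional[OF I \<O>_K[OF c(1)] c(2)])
    have "I' \<subseteq> \<O>"
      using c(3) by (auto simp: I'_def)
    obtain x0 where "x0 \<in> I'" "x0 \<noteq> 0"
      by (rule fractional_ideal_nonzero[OF I'])
    then obtain x where x: "x \<in> I'" "x \<noteq> 0" "\<And>y. y \<in> I' \<Longrightarrow> cmod y < cmod x \<Longrightarrow> y = 0"
      using exists_min_norm[OF \<open>I' \<subseteq> \<O>\<close>] by metis
    have "x \<in> K"
      using x(1) \<open>I' \<subseteq> \<O>\<close> \<O>_K by auto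
    have main: "of_int m / x * y \<in> \<O>" if "y \<in> I'" for y
    proof -
      have "y / x \<in> K"
        unfolding divide_inverse using that \<open>I' \<subseteq> \<O>\<close> \<O>_K
        by (intro K_mult K_inverse \<open>x \<in> K\<close>) auto
      then obtain t w where t: "0 < t" "t \<le> int M" "w \<in> \<O>" "cmod (of_int t * (y / x) - w) < 1"
        using M by meson
      define z where "z = of_int t * y + (- w) * x"
      have "z \<in> I'"
        unfolding z_def
        by (intro fractional_ideal_module(2,3)[OF I'] \<O>_of_int \<O>_uminus t(3) x(1) \<open>y \<in> I'\<close>)
      have "z = (of_int t * (y / x) - w) * x"
        using x(2) by (simp add: z_def algebra_simps)
      then have "cmod z < cmod x"
        using t(4) x(2) by (simp add: norm_mult)
      then have "z = 0"
        using x(3) \<open>z \<in> I'\<close> by blast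
      then have ty: "of_int t * y = w * x"
        by (simp add: z_def)
      have "nat t dvd fact M"
        using t(1,2) by (intro dvd_fact) auto
      then have "t dvd m"
        using t(1) by (metis int_dvd_int_iff int_nat_eq less_imp_le m_def of_nat_fact)
      then obtain k where k: "m = t * k" ..
      have "of_int m / x * y = of_int k * (of_int t * y) / x"
        by (simp add: k)
      also have "\<dots> = of_int k * w"
        using x(2) by (simp add: ty)
      finally show ?thesis
        by (simp add: \<O>_mult \<O>_of_int t(3))
    qed
    define r where "r = of_int m / x * c"
    have "r \<in> K"
      unfolding r_def divide_inverse by (intro K_mult K_inverse K_of_int \<open>x \<in> K\<close> \<O>_K[OF c(1)])
    moreover have "r \<noteq> 0"
      using c(2) x(2) \<open>m > 0\<close> by (simp add: r_def)
    moreover have "r * y \<in> \<O>" if "y \<in> I" for y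
    proof -
      have "c * y \<in> I'"
        unfolding I'_def using that by (rule imageI)
      then show ?thesis
        using main by (simp add: r_def mult.assoc)
    qed
    then have "(*) r ` I \<subseteq> \<O>"
      by blast
    moreover have "of_int m \<in> (*) r ` I"
    proof -
      obtain y where "y \<in> I" "x = c * y"
        using x(1) unfolding I'_def by (elim imageE)
      moreover have "of_int m = r * y"
        using x(2) \<open>x = c * y\<close> by (simp add: r_def)
      ultimately show ?thesis
        by (simp only: imageI)
    qed
    ultimately show ?thesis
      by (intro bexI[of _ r] conjI)
  qed
  then show thesis
    using that \<open>m > 0\<close> by blast
qed

text \<open>
  A module containing \<open>m\<close> is a union of cosets of \<open>m \<O>\<close>. The trace form against the elements \<open>1\<close>
  and \<open>sqrtD\<close> sends \<open>\<O>\<close> to pairs of integers; pairs that agree modulo \<open>2 D m\<close> come from the same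
  coset, so there are finitely many cosets.
\<close>

lemma finite_intermediate_modules:
  assumes "m > 0"
  shows "finite {J. integral_module J \<and> J \<subseteq> \<O> \<and> of_int m \<in> J}" (is "finite ?F")
proof -
  define tr where "tr x = \<lfloor>Re (x + cnj x)\<rfloor>" for x
  have tr: "x + cnj x = of_int (tr x)" if x: "x \<in> \<O>" for x
  proof -
    obtain k where "x + cnj x = of_int k"
      using trace_norm_Ints(1)[OF x] by (elim Ints_cases)
    then show ?thesis
      by (simp add: tr_def)
  qed
  \<comment> \<open>Recovering \<open>d\<close> from the traces of \<open>d\<close> and \<open>d sqrtD\<close> costs a factor \<open>2 D\<close>; the sign makes \<open>n\<close> positive.\<close>
  define n where "n = - 2 * D * m"
  have "n > 0"
    using D_neg assms by (simp add: n_def mult_neg_pos)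
  define \<phi> where "\<phi> x = (tr x mod n, tr (x * sqrtD) mod n)" for x
  have \<phi>: "\<exists>w\<in>\<O>. x - y = w * of_int m" if x: "x \<in> \<O>" and y: "y \<in> \<O>" and eq: "\<phi> x = \<phi> y" for x y
  proof -
    obtain k where k: "tr x - tr y = n * k"
      using eq by (auto simp: \<phi>_def mod_eq_dvd_iff)
    obtain l where l: "tr (x * sqrtD) - tr (y * sqrtD) = n * l"
      using eq by (auto simp: \<phi>_def mod_eq_dvd_iff)
    define d where "d = x - y"
    have "d + cnj d = (x + cnj x) - (y + cnj y)"
      by (simp add: d_def)
    also have "\<dots> = of_int (tr x - tr y)"
      by (simp add: tr x y)
    finally have d1: "d + cnj d = of_int n * of_int k"
      unfolding k by simp
    have "(d - cnj d) * sqrtD = (x * sqrtD + cnj (x * sqrtD)) - (y * sqrtD + cnj (y * sqrtD))"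
      by (simp add: d_def cnj_sqrtD algebra_simps)
    also have "\<dots> = of_int (tr (x * sqrtD) - tr (y * sqrtD))"
      using tr[OF \<O>_mult[OF x \<O>_sqrtD]] tr[OF \<O>_mult[OF y \<O>_sqrtD]] by simp
    finally have d2: "(d - cnj d) * sqrtD = of_int n * of_int l"
      unfolding l by simp
    have "2 * of_int D * d = (d + cnj d) * (sqrtD * sqrtD) + (d - cnj d) * sqrtD * sqrtD"
      unfolding mult.assoc sqrtD_square by (simp add: algebra_simps)
    also have "\<dots> = of_int n * of_int k * of_int D + of_int n * of_int l * sqrtD"
      unfolding d1 d2 sqrtD_square ..
    also have "\<dots> = 2 * of_int D * (- (of_int k * of_int D + of_int l * sqrtD) * of_int m)"
      by (simp add: n_def algebra_simps)
    finally have "d = - (of_int k * of_int D + of_int l * sqrtD) * of_int m"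
      using D_neg by simp
    moreover have "- (of_int k * of_int D + of_int l * sqrtD) \<in> \<O>"
      by (intro \<O>_uminus \<O>_add \<O>_mult \<O>_of_int \<O>_sqrtD)
    ultimately show ?thesis
      unfolding d_def by (rule bexI)
  qed
  have sub: "J \<subseteq> J'" if J: "J \<in> ?F" and J': "J' \<in> ?F" and eq: "\<phi> ` J = \<phi> ` J'" for J J'
  proof
    fix x assume "x \<in> J"
    then have "\<phi> x \<in> \<phi> ` J'"
      using eq by blast
    then obtain y where y: "y \<in> J'" "\<phi> x = \<phi> y"
      by blast
    moreover have "x \<in> \<O>" "y \<in> \<O>"
      using \<open>x \<in> J\<close> y(1) J J' by auto
    ultimately obtain w where w: "w \<in> \<O>" "x - y = w * of_int m"
      using \<phi> by metis
    then have "x = y + w * of_int m"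
      by (simp add: algebra_simps)
    moreover have "y + w * of_int m \<in> J'"
      using J' y(1) w(1) by (intro integral_moduleD) auto
    ultimately show "x \<in> J'"
      by simp
  qed
  have "inj_on (image \<phi>) ?F"
    by (intro inj_onI equalityI sub) (simp_all add: eq_commute)
  moreover have "image \<phi> ` ?F \<subseteq> Pow ({0..<n} \<times> {0..<n})"
    using \<open>n > 0\<close> by (auto simp: \<phi>_def)
  ultimately show ?thesis
    by (rule inj_on_finite) simp
qed

lemma finite_class_group: "finite (carrier (class_group K))"
proof -
  obtain m where "m > 0" and m: "\<And>I. I \<in> fractional_ideals K \<Longrightarrow>
    \<exists>x\<in>K. x \<noteq> 0 \<and> (*) x ` I \<subseteq> \<O> \<and> of_int m \<in> (*) x ` I"
    using bounded_representative by metis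
  let ?F = "{J. integral_module J \<and> J \<subseteq> \<O> \<and> of_int m \<in> J}"
  have "carrier (class_group K) \<subseteq> (\<lambda>J. \<P> #>\<^bsub>\<I>\<^esub> J) ` ?F"
  proof
    fix C assume "C \<in> carrier (class_group K)"
    then obtain I where I: "I \<in> fractional_ideals K" "C = \<P> #>\<^bsub>\<I>\<^esub> I"
      by (auto simp: class_group_def carrier_FactGroup)
    obtain x where x: "x \<in> K" "x \<noteq> 0" "(*) x ` I \<subseteq> \<O>" "of_int m \<in> (*) x ` I"
      using m[OF I(1)] by blast
    have "integral_module ((*) x ` I)"
      using scaled_fractional[OF I(1) x(1,2)] by (simp add: fractional_ideals_iff)
    moreover have "(*) x ` I \<in> \<P> #>\<^bsub>\<I>\<^esub> I"
      using principal_in[OF x(1,2)] principal_star[OF I(1), of x] by (force simp: r_coset_def)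
    then have "C = \<P> #>\<^bsub>\<I>\<^esub> ((*) x ` I)"
      unfolding I(2) by (rule \<I>.repr_independence) (simp_all add: I(1) subgroup_principal)
    ultimately show "C \<in> (\<lambda>J. \<P> #>\<^bsub>\<I>\<^esub> J) ` ?F"
      using x(3,4) by blast
  qed
  then show ?thesis
    using finite_intermediate_modules[OF \<open>m > 0\<close>] finite_surj by blast
qed

section \<open>Traces of prime powers\<close>

lemma \<O>_sum: "(\<And>i. i \<in> A \<Longrightarrow> f i \<in> \<O>) \<Longrightarrow> sum f A \<in> \<O>"
  by (induction A rule: infinite_finite_induct) (simp_all add: \<O>_0 \<O>_add)

text \<open>
  The inner binomial coefficients are multiples of \<open>q\<close>. So \<open>a\<^sup>q - v\<close> is \<open>q\<close> times an element of \<open>\<O>\<close>,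
  and this element is rational, hence a rational integer.
\<close>

lemma trace_power_prime_cong:
  assumes x: "x \<in> \<O>" and "Factorial_Ring.prime q"
    and a: "x + cnj x = of_int a" and v: "x ^ q + cnj x ^ q = of_int v"
  shows "int q dvd a ^ q - v"
proof -
  have "q > 0" using assms(2) by (simp add: prime_gt_0_nat)
  define E where "E = (\<Sum>i\<in>{1..<q}. of_nat ((q choose i) div q) * x ^ i * cnj x ^ (q - i))"
  have "E \<in> \<O>"
    unfolding E_def using \<O>_Ints[OF Ints_of_nat] x
    by (intro \<O>_sum \<O>_mult \<O>_power \<O>_cnj) simp_all
  have "of_int (a ^ q) = (\<Sum>i\<le>q. of_nat (q choose i) * x ^ i * cnj x ^ (q - i))"
    using binomial_ring[of x "cnj x" q] by (simp add: a)
  also have "{..q} = insert 0 (insert q {1..<q})"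
    using \<open>q > 0\<close> by auto
  also have "(\<Sum>i\<in>insert 0 (insert q {1..<q}). of_nat (q choose i) * x ^ i * cnj x ^ (q - i))
      = cnj x ^ q + (x ^ q + (\<Sum>i\<in>{1..<q}. of_nat (q choose i) * x ^ i * cnj x ^ (q - i)))"
    using \<open>q > 0\<close> by simp
  also have "(\<Sum>i\<in>{1..<q}. of_nat (q choose i) * x ^ i * cnj x ^ (q - i)) = of_nat q * E"
    unfolding E_def sum_distrib_left
  proof (rule sum.cong[OF refl])
    fix i assume i: "i \<in> {1..<q}"
    then have "q dvd q choose i"
      using assms(2) by (intro dvd_choose_prime) auto
    then have "(of_nat (q choose i) :: complex) = of_nat q * of_nat ((q choose i) div q)"
      by (metis dvd_mult_div_cancel of_nat_mult)
    then show "of_nat (q choose i) * x ^ i * cnj x ^ (q - i)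
        = of_nat q * (of_nat ((q choose i) div q) * x ^ i * cnj x ^ (q - i))"
      by simp
  qed
  also have "cnj x ^ q + (x ^ q + of_nat q * E) = of_int v + of_nat q * E"
    by (simp flip: v)
  finally have qE: "of_int (a ^ q - v) = of_nat q * E"
    by simp
  then have "E = of_int (a ^ q - v) / of_nat q"
    using \<open>q > 0\<close> by simp
  then have "E \<in> \<rat>"
    by simp
  then have "E \<in> \<int>"
    by (rule \<O>_Rats[OF \<open>E \<in> \<O>\<close>])
  then obtain e where "E = of_int e"
    by (elim Ints_cases)
  then have "(of_int (a ^ q - v) :: complex) = of_int (int q * e)"
    using qE by simp
  then have "a ^ q - v = int q * e"
    by (simp only: of_int_eq_iff)
  then show ?thesis
    by simp
qed

text \<open>
  If the trace of \<open>x\<^sup>q\<close> were \<open>q\<close>, the trace \<open>a\<close> of \<open>x\<close> would be divisible by \<open>q\<close> by Fermat's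
  congruence. Then \<open>q a\<close> and \<open>a\<^sup>2\<close> are both divisible by \<open>q\<^sup>2\<close>, and so is the trace of \<open>x\<^sup>q\<close>.
\<close>

lemma trace_prime_power_neq:
  assumes x: "x \<in> \<O>" and q: "Factorial_Ring.prime q" "odd q"
  shows "x ^ q + cnj x ^ q \<noteq> of_nat q"
proof
  assume eq: "x ^ q + cnj x ^ q = of_nat q"
  obtain a where a: "x + cnj x = of_int a"
    using trace_norm_Ints(1)[OF x] by (elim Ints_cases)
  obtain P where P: "x * cnj x = of_int P"
    using trace_norm_Ints(2)[OF x] by (elim Ints_cases)
  have "int q dvd a ^ q - int q"
    using trace_power_prime_cong[OF x q(1) a, of "int q"] eq by simp
  then have "int q dvd a ^ q"
    using dvd_add[OF _ dvd_refl, of "int q" "a ^ q - int q"] by simp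
  then have "int q dvd a"
    using q(1) by (metis prime_dvd_power prime_nat_int_transfer)
  then obtain b where b: "a = int q * b" ..
  obtain k where k: "q = 2 * k + 1"
    using q(2) by (elim oddE)
  obtain s where "x ^ q + cnj x ^ q = of_int ((2 * int k + 1) * a * (- P) ^ k + a\<^sup>2 * s)"
    using power_sums_mod_trace_square[OF a P, of k] unfolding k by blast
  then have "(of_int (int q) :: complex) = of_int ((2 * int k + 1) * a * (- P) ^ k + a\<^sup>2 * s)"
    using eq by simp
  then have "int q = (2 * int k + 1) * a * (- P) ^ k + a\<^sup>2 * s"
    by (simp only: of_int_eq_iff)
  also have "2 * int k + 1 = int q"
    by (simp add: k)
  also have "int q * a * (- P) ^ k + a\<^sup>2 * s = int q * (int q * (b * (- P) ^ k + b\<^sup>2 * s))"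
    by (simp add: b power2_eq_square algebra_simps)
  finally have "int q * (b * (- P) ^ k + b\<^sup>2 * s) = 1"
    using q(1) prime_gt_0_nat by (metis mult_cancel_left2 of_nat_0_less_iff less_irrefl)
  then have "int q dvd 1"
    by (metis dvd_triv_left)
  then show False
    using q(1) by (metis not_prime_unit prime_nat_int_transfer)
qed

section \<open>Units\<close>

lemma unit_norm:
  assumes "u \<in> \<O>" "w \<in> \<O>" "u * w = 1"
  shows "u * cnj u = 1"
proof -
  obtain m where m: "u * cnj u = of_int m"
    using trace_norm_Ints(2)[OF assms(1)] by (elim Ints_cases)
  obtain n where n: "w * cnj w = of_int n"
    using trace_norm_Ints(2)[OF assms(2)] by (elim Ints_cases)
  have "(of_int (m * n) :: complex) = (u * w) * cnj (u * w)"
    by (simp add: m[symmetric] n[symmetric])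
  then have "m * n = 1"
    using assms(3) by (metis complex_cnj_one mult_1 of_int_1 of_int_eq_iff)
  moreover have "m \<ge> 0"
  proof -
    have "real_of_int m = Re (u * cnj u)"
      by (simp add: m)
    then show ?thesis
      by (simp add: complex_mult_cnj flip: of_int_0_le_iff[where 'a = real])
  qed
  ultimately have "m = 1"
    by (auto simp: zmult_eq_1_iff)
  then show ?thesis
    using m by simp
qed

text \<open>
  Both \<open>z\<close> and \<open>sqrtD\<close> are purely imaginary, so their product is real, hence rational, hence a
  rational integer. Its square is \<open>- 3 D\<close>, so it is divisible by \<open>3\<close>, and \<open>3 D\<close> is divisible by \<open>9\<close>.
\<close>

lemma three_dvd_if_sqrt_minus_three:
  assumes "z \<in> \<O>" "z * z = -3" "cnj z = - z"
  shows "3 dvd D"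
proof -
  have "cnj (z * sqrtD) = z * sqrtD"
    by (simp add: assms(3) cnj_sqrtD)
  then have "z * sqrtD + z * sqrtD \<in> \<rat>"
    using K_trace_Rats[OF K_mult[OF \<O>_K[OF assms(1)] K_sqrtD]] by simp
  then have "(z * sqrtD + z * sqrtD) / 2 \<in> \<rat>"
    by (rule Rats_divide) simp
  then have "z * sqrtD \<in> \<int>"
    using \<O>_Rats[OF \<O>_mult[OF assms(1) \<O>_sqrtD]] by simp
  then obtain n where n: "z * sqrtD = of_int n"
    by (elim Ints_cases)
  have "(of_int (n * n) :: complex) = (z * z) * (sqrtD * sqrtD)"
    by (simp add: n[symmetric])
  also have "\<dots> = of_int (- 3 * D)"
    by (simp add: assms(2) sqrtD_square)
  finally have nn: "n * n = - 3 * D"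
    by (simp only: of_int_eq_iff)
  then have "3 dvd n * n"
    by simp
  then have "3 dvd n"
    by (simp add: prime_dvd_mult_iff)
  then obtain k where "n = 3 * k" ..
  then have "D = 3 * (- k * k)"
    using nn by simp
  then show ?thesis
    by (metis dvd_triv_left)
qed

text \<open>
  A number on the unit circle has a trace of absolute value at most \<open>2\<close>. Trace \<open>1\<close> or \<open>- 1\<close> gives a
  primitive sixth or third root of unity, so \<open>K\<close> contains a square root of \<open>- 3\<close>.
\<close>

lemma unit_root_of_unity:
  assumes u: "u \<in> \<O>" "u * cnj u = 1"
  shows "u ^ 4 = 1 \<or> u ^ 6 = 1 \<and> 3 dvd D"
proof -
  obtain t where t: "u + cnj u = of_int t"
    using trace_norm_Ints(1)[OF u(1)] by (elim Ints_cases)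
  have "cmod u * cmod u = 1"
    using arg_cong[OF u(2), of cmod] by (simp add: norm_mult)
  then have "cmod u = 1"
    by (metis abs_norm_cancel abs_of_nonneg mult_cancel_right2 norm_ge_zero real_sqrt_abs2 real_sqrt_one)
  then have "cmod (of_int t) \<le> 2"
    using norm_triangle_ineq[of u "cnj u"] t by simp
  then have "\<bar>t\<bar> \<le> 2"
    by simp
  have quad: "u * u = of_int t * u - 1"
    unfolding t[symmetric] using u(2) by (simp add: algebra_simps)
  have cnj_u: "cnj u = of_int t - u"
    using t by (simp add: algebra_simps)
  consider "t = 2" | "t = - 2" | "t = 0" | "t = 1" | "t = - 1"
    using \<open>\<bar>t\<bar> \<le> 2\<close> by linarith
  then show ?thesis
  proof cases
    case 1
    have "(u - 1) * (u - 1) = u * u - (of_int t * u - 1)"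
      by (simp add: 1 algebra_simps)
    then have "(u - 1) * (u - 1) = 0"
      using quad by simp
    then show ?thesis by simp
  next
    case 2
    have "(u + 1) * (u + 1) = u * u - (of_int t * u - 1)"
      by (simp add: 2 algebra_simps)
    then have "(u + 1) * (u + 1) = 0"
      using quad by simp
    then have "u = - 1"
      by (simp add: add_eq_0_iff2)
    then show ?thesis by simp
  next
    case 3
    then have "u * u = - 1"
      using quad by simp
    moreover have "u ^ 4 = (u * u) * (u * u)"
      by (simp add: eval_nat_numeral)
    ultimately show ?thesis by simp
  next
    case 4
    then have q: "u * u = u - 1"
      using quad by simp
    have "u ^ 6 = (u * u) * (u * u) * (u * u)"
      by (simp add: eval_nat_numeral)
    also have "\<dots> = 1"
      by (simp add: q algebra_simps)
    finally have "u ^ 6 = 1" .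
    moreover have "3 dvd D"
    proof (rule three_dvd_if_sqrt_minus_three)
      show "2 * u - 1 \<in> \<O>"
        using \<O>_diff[OF \<O>_mult[OF \<O>_of_int[of 2] u(1)] \<O>_1] by simp
      have "(2 * u - 1) * (2 * u - 1) = 4 * (u * u) - 4 * u + 1"
        by (simp add: algebra_simps)
      then show "(2 * u - 1) * (2 * u - 1) = - 3"
        by (simp add: q)
      show "cnj (2 * u - 1) = - (2 * u - 1)"
        using 4 by (simp add: cnj_u)
    qed
    ultimately show ?thesis by simp
  next
    case 5
    then have q: "u * u = - u - 1"
      using quad by simp
    have "u ^ 6 = (u * u) * (u * u) * (u * u)"
      by (simp add: eval_nat_numeral)
    also have "\<dots> = 1"
      by (simp add: q algebra_simps)
    finally have "u ^ 6 = 1" .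
    moreover have "3 dvd D"
    proof (rule three_dvd_if_sqrt_minus_three)
      show "2 * u + 1 \<in> \<O>"
        using \<O>_add[OF \<O>_mult[OF \<O>_of_int[of 2] u(1)] \<O>_1] by simp
      have "(2 * u + 1) * (2 * u + 1) = 4 * (u * u) + 4 * u + 1"
        by (simp add: algebra_simps)
      then show "(2 * u + 1) * (2 * u + 1) = - 3"
        by (simp add: q)
      show "cnj (2 * u + 1) = - (2 * u + 1)"
        using 5 by (simp add: cnj_u)
    qed
    ultimately show ?thesis by simp
  qed
qed

text \<open>
  The square of an odd number is \<open>1\<close> modulo \<open>4\<close>, and \<open>1\<close> modulo \<open>6\<close> if the number is prime to \<open>3\<close>. So
  \<open>u\<^sup>q\<close> is a \<open>q\<close>-th root of \<open>u\<close>.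
\<close>

lemma unit_prime_power:
  assumes u: "u \<in> \<O>" "u * cnj u = 1"
    and q: "Factorial_Ring.prime q" "odd q" and not3: "\<not> (q = 3 \<and> 3 dvd D)"
  shows "(u ^ q) ^ q = u"
proof -
  have eq: "(u ^ q) ^ q = u" if "u ^ n = 1" "q * q mod n = 1" for n
  proof -
    have "q * q = n * (q * q div n) + 1"
      using that(2) by (metis mult_div_mod_eq)
    then have "u ^ (q * q) = (u ^ n) ^ (q * q div n) * u"
      by (metis power_add power_mult power_one_right)
    then show ?thesis
      using that(1) by (simp add: power_mult)
  qed
  consider "u ^ 4 = 1" | "u ^ 6 = 1" "3 dvd D"
    using unit_root_of_unity[OF u] by blast
  then show ?thesis
  proof cases
    case 1
    have "q mod 4 = 1 \<or> q mod 4 = 3"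
      using q(2) by presburger
    then have "q * q mod 4 = 1"
      using mod_mult_eq[of q 4 q] by auto
    with 1 show ?thesis by (rule eq)
  next
    case 2
    then have "\<not> 3 dvd q"
      using not3 q(1) primes_dvd_imp_eq[of 3 q] by auto
    then have "q mod 6 = 1 \<or> q mod 6 = 5"
      using q(2) by presburger
    then have "q * q mod 6 = 1"
      using mod_mult_eq[of q 6 q] by auto
    with 2(1) show ?thesis by (rule eq)
  qed
qed

lemma principal_eqD:
  assumes "principal x = principal y" "y \<noteq> 0"
  obtains u where "u \<in> \<O>" "u * cnj u = 1" "x = u * y"
proof -
  have "x \<in> principal y" "y \<in> principal x"
    using assms(1) imageI[OF \<O>_1, of "(*) x"] imageI[OF \<O>_1, of "(*) y"] by simp_all
  then obtain u w where uw: "u \<in> \<O>" "x = y * u" "w \<in> \<O>" "y = x * w"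
    by (elim imageE) metis
  then have "y * (u * w) = y"
    by (metis mult.assoc)
  then have "u * w = 1"
    using assms(2) by simp
  then show thesis
    using that[OF uw(1) unit_norm[OF uw(1,3)]] uw(2) by (metis mult.commute)
qed

section \<open>An ideal class of order a prime power\<close>

definition two_generated_ideal :: "complex \<Rightarrow> complex \<Rightarrow> complex set" where
  "two_generated_ideal a b = {a * x + b * y | x y. x \<in> \<O> \<and> y \<in> \<O>}"

lemma two_generated_idealI: "x \<in> \<O> \<Longrightarrow> y \<in> \<O> \<Longrightarrow> a * x + b * y \<in> two_generated_ideal a b"
  by (auto simp: two_generated_ideal_def)

lemma two_generated_ideal_add:
  assumes "s \<in> two_generated_ideal a b" and "t \<in> two_generated_ideal a b"
  shows "s + t \<in> two_generated_ideal a b"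
proof -
  from assms obtain x y x' y' where *: "x \<in> \<O>" "y \<in> \<O>" "s = a * x + b * y" "x' \<in> \<O>" "y' \<in> \<O>" "t = a * x' + b * y'"
    unfolding two_generated_ideal_def by blast
  have "s + t = a * (x + x') + b * (y + y')"
    by (simp add: * algebra_simps)
  then show "s + t \<in> two_generated_ideal a b"
    using * by (simp add: two_generated_idealI \<O>_add)
qed

lemma two_generated_ideal_fractional:
  assumes a: "a \<in> \<O>" "a \<noteq> 0" and b: "b \<in> \<O>"
  shows "two_generated_ideal a b \<in> fractional_ideals K"
proof (rule fractional_idealI[of _ a 1])
  have sub: "s \<in> \<O>" if "s \<in> two_generated_ideal a b" for s
    using that a b by (auto simp: two_generated_ideal_def intro!: \<O>_add \<O>_mult)
  show "two_generated_ideal a b \<subseteq> K"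
    using sub \<O>_K by blast
  show "1 * s \<in> \<O>" if "s \<in> two_generated_ideal a b" for s
    using sub[OF that] by simp
  show "a \<in> two_generated_ideal a b"
    using two_generated_idealI[OF \<O>_1 \<O>_0, of a b] by simp
  show "integral_module (two_generated_ideal a b)"
  proof (rule integral_moduleI)
    show "0 \<in> two_generated_ideal a b"
      using two_generated_idealI[OF \<O>_0 \<O>_0, of a b] by simp
    show "c * s \<in> two_generated_ideal a b" if c: "c \<in> \<O>" and s: "s \<in> two_generated_ideal a b" for c s
    proof -
      obtain x y where *: "x \<in> \<O>" "y \<in> \<O>" "s = a * x + b * y"
        using s unfolding two_generated_ideal_def by blast
      have "c * s = a * (c * x) + b * (c * y)"
        by (simp add: *(3) algebra_simps)
      then show ?thesis
        using two_generated_idealI[OF \<O>_mult[OF c *(1)] \<O>_mult[OF c *(2)]] by simp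
    qed
  qed (rule two_generated_ideal_add)
qed (use a \<O>_1 in simp_all)

text \<open>
  The powers of \<open>A = (p, \<alpha>)\<close> satisfy \<open>A\<^sup>k \<subseteq> (p\<^sup>k, \<alpha>)\<close>, which for \<open>k = n\<close> is \<open>(\<alpha>)\<close> because \<open>\<alpha>\<close>
  divides its norm \<open>p\<^sup>n\<close>. Conversely \<open>A\<^sup>n\<close> contains \<open>p\<^sup>n = \<alpha> cnj \<alpha>\<close> and \<open>\<alpha>\<^sup>n\<close>, and these generate
  \<open>\<alpha>\<close>: the numbers \<open>cnj \<alpha>\<close> and \<open>\<alpha> ^ (n - 1)\<close> are coprime, since the ideal that they generate contains
  the coprime integers \<open>t ^ (n - 1)\<close> and \<open>p\<^sup>n\<close>.
\<close>

lemma two_generated_ideal_power: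
  assumes p: "p \<noteq> 0" and \<alpha>: "\<alpha> \<in> \<O>" and n: "n \<ge> 1"
    and norm: "\<alpha> * cnj \<alpha> = of_int p ^ n"
    and trace: "\<alpha> + cnj \<alpha> = of_int t" and "Rings.coprime t p"
  shows "two_generated_ideal (of_int p) \<alpha> [^]\<^bsub>\<I>\<^esub> n = principal \<alpha>"
proof -
  define A where "A = two_generated_ideal (of_int p) \<alpha>"
  have A: "A \<in> fractional_ideals K"
    unfolding A_def using p \<alpha> by (intro two_generated_ideal_fractional \<O>_of_int) simp_all
  have upper: "A [^]\<^bsub>\<I>\<^esub> k \<subseteq> two_generated_ideal (of_int p ^ k) \<alpha>" for k :: nat
  proof (induction k)
    case 0
    show ?case
      using two_generated_idealI[OF _ \<O>_0, of _ 1 \<alpha>] by auto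
  next
    case (Suc k)
    have "A [^]\<^bsub>\<I>\<^esub> k \<star> A \<subseteq> two_generated_ideal (of_int p ^ Suc k) \<alpha>"
    proof (rule star_subsetI)
      fix s s' assume "s \<in> A [^]\<^bsub>\<I>\<^esub> k" "s' \<in> A"
      then obtain x y x' y' where *: "x \<in> \<O>" "y \<in> \<O>" "s = of_int p ^ k * x + \<alpha> * y"
        "x' \<in> \<O>" "y' \<in> \<O>" "s' = of_int p * x' + \<alpha> * y'"
        using Suc.IH unfolding A_def two_generated_ideal_def by blast
      have "s * s' = of_int p ^ Suc k * (x * x')
          + \<alpha> * (of_int (p ^ k) * x * y' + (of_int p * x' + \<alpha> * y') * y)"
        by (simp add: * algebra_simps)
      moreover have "x * x' \<in> \<O>" "of_int (p ^ k) * x * y' + (of_int p * x' + \<alpha> * y') * y \<in> \<O>"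
        by (intro \<O>_add \<O>_mult \<O>_of_int \<alpha> *)+
      ultimately show "s * s' \<in> two_generated_ideal (of_int p ^ Suc k) \<alpha>"
        using two_generated_idealI by metis
    qed (rule two_generated_ideal_add)
    then show ?case
      by simp
  qed
  have pow: "x ^ k \<in> A [^]\<^bsub>\<I>\<^esub> k" if "x \<in> A" for x and k :: nat
  proof (induction k)
    case (Suc k)
    then show ?case
      using star_multI[OF Suc that] by (simp add: mult.commute)
  qed (simp add: \<O>_1)
  show ?thesis
    unfolding A_def[symmetric]
  proof
    show "A [^]\<^bsub>\<I>\<^esub> n \<subseteq> principal \<alpha>"
    proof
      fix s assume "s \<in> A [^]\<^bsub>\<I>\<^esub> n"
      then obtain x y where *: "x \<in> \<O>" "y \<in> \<O>" "s = of_int p ^ n * x + \<alpha> * y"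
        using upper[of n] unfolding two_generated_ideal_def by blast
      have "s = \<alpha> * (cnj \<alpha> * x + y)"
        unfolding *(3) norm[symmetric] by (simp add: algebra_simps)
      moreover have "cnj \<alpha> * x + y \<in> \<O>"
        by (intro \<O>_add \<O>_mult \<O>_cnj \<alpha> *)
      ultimately show "s \<in> principal \<alpha>"
        by (simp only: imageI)
    qed
  next
    have An: "A [^]\<^bsub>\<I>\<^esub> n \<in> fractional_ideals K"
      using \<I>.nat_pow_closed[of A n] A by simp
    \<comment> \<open>The binomial expansion modulo \<open>cnj \<alpha>\<close>.\<close>
    have trace_pow: "\<exists>e\<in>\<O>. (\<alpha> + cnj \<alpha>) ^ k = \<alpha> ^ k + cnj \<alpha> * e" for k
    proof (induction k)
      case 0
      show ?case
        by (intro bexI[of _ 0]) (simp_all add: \<O>_0)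
    next
      case (Suc k)
      then obtain e where e: "e \<in> \<O>" "(\<alpha> + cnj \<alpha>) ^ k = \<alpha> ^ k + cnj \<alpha> * e" by blast
      have "(\<alpha> + cnj \<alpha>) ^ Suc k = \<alpha> ^ Suc k + cnj \<alpha> * (\<alpha> ^ k + (\<alpha> + cnj \<alpha>) * e)"
        unfolding power_Suc e(2) by (simp add: algebra_simps)
      moreover have "\<alpha> ^ k + (\<alpha> + cnj \<alpha>) * e \<in> \<O>"
        by (intro \<O>_add \<O>_mult \<O>_cnj \<O>_power \<alpha> e)
      ultimately show ?case
        by blast
    qed
    obtain e where e: "e \<in> \<O>" "(\<alpha> + cnj \<alpha>) ^ (n - 1) = \<alpha> ^ (n - 1) + cnj \<alpha> * e"
      using trace_pow by blast
    have "Rings.coprime (t ^ (n - 1)) (p ^ n)"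
      using assms(6) by simp
    then obtain u v where uv: "u * t ^ (n - 1) + v * p ^ n = 1"
      by (metis bezout_int coprime_imp_gcd_eq_1)
    have "1 = (of_int (u * t ^ (n - 1) + v * p ^ n) :: complex)"
      by (simp only: uv of_int_1)
    also have "\<dots> = of_int u * (\<alpha> + cnj \<alpha>) ^ (n - 1) + of_int v * (\<alpha> * cnj \<alpha>)"
      by (simp add: norm trace)
    also have "\<dots> = of_int u * \<alpha> ^ (n - 1) + cnj \<alpha> * (of_int u * e + of_int v * \<alpha>)"
      unfolding e(2) by (simp add: algebra_simps)
    finally have "\<alpha> * 1 = \<alpha> * (of_int u * \<alpha> ^ (n - 1) + cnj \<alpha> * (of_int u * e + of_int v * \<alpha>))"
      by simp
    also have "\<dots> = of_int u * (\<alpha> * \<alpha> ^ (n - 1)) + (of_int u * e + of_int v * \<alpha>) * (\<alpha> * cnj \<alpha>)"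
      by (simp add: algebra_simps)
    also have "\<alpha> * \<alpha> ^ (n - 1) = \<alpha> ^ n"
      using n by (simp flip: power_Suc)
    finally have \<alpha>_eq: "\<alpha> = of_int u * \<alpha> ^ n + (of_int u * e + of_int v * \<alpha>) * of_int p ^ n"
      by (simp add: norm)
    have "\<alpha> \<in> A" "of_int p \<in> A"
      using two_generated_idealI[OF \<O>_0 \<O>_1, of "of_int p" \<alpha>] two_generated_idealI[OF \<O>_1 \<O>_0, of "of_int p" \<alpha>]
      by (simp_all add: A_def)
    then have "of_int u * \<alpha> ^ n + (of_int u * e + of_int v * \<alpha>) * of_int p ^ n \<in> A [^]\<^bsub>\<I>\<^esub> n"
      by (intro fractional_ideal_module(2,3)[OF An] pow \<O>_add \<O>_mult \<O>_of_int e(1) \<alpha>)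
    then have "\<alpha> \<in> A [^]\<^bsub>\<I>\<^esub> n"
      using \<alpha>_eq by simp
    then show "principal \<alpha> \<subseteq> A [^]\<^bsub>\<I>\<^esub> n"
      using fractional_ideal_module(3)[OF An] by (auto simp: mult.commute)
  qed
qed

lemma principal_power:
  assumes "x \<in> K" "x \<noteq> 0"
  shows "principal x [^]\<^bsub>\<I>\<^esub> (n :: nat) = principal (x ^ n)"
proof (induction n)
  case (Suc n)
  then show ?case
    using principal_star_principal[OF assms, of "x ^ n"] by (simp add: mult.commute)
qed simp

text \<open>
  The class of \<open>(p, \<alpha>)\<close> has order exactly \<open>q ^ m\<close>; otherwise \<open>\<alpha>\<close>, whose trace is \<open>q\<close>, would be
  the \<open>q\<close>-th power of an integer of \<open>K\<close>.
\<close>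

theorem prime_power_dvd_class_number:
  assumes p: "p \<noteq> 0" and q: "Factorial_Ring.prime q" "odd q" and m: "m \<ge> 1"
    and \<alpha>: "\<alpha> \<in> \<O>" and norm: "\<alpha> * cnj \<alpha> = of_int p ^ (q ^ m)" and trace: "\<alpha> + cnj \<alpha> = of_nat q"
    and coprime: "Rings.coprime (int q) p" and not3: "\<not> (q = 3 \<and> 3 dvd D)"
  shows "q ^ m dvd class_number K"
proof -
  define A where "A = two_generated_ideal (of_int p) \<alpha>"
  have A: "A \<in> carrier \<I>"
    unfolding A_def using p \<alpha> two_generated_ideal_fractional \<O>_of_int by simp
  have "q > 0"
    using q(1) by (simp add: prime_gt_0_nat)
  have "\<alpha> \<noteq> 0"
    using norm p by auto
  have A_pow: "A [^]\<^bsub>\<I>\<^esub> (q ^ m) = principal \<alpha>"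
    unfolding A_def using \<open>q > 0\<close> trace
    by (intro two_generated_ideal_power[OF p \<alpha> _ norm _ coprime]) simp_all
  define G where "G = class_group K"
  interpret G: group G
    unfolding G_def class_group_def by (rule \<P>.factorgroup_is_group)
  define a where "a = \<P> #>\<^bsub>\<I>\<^esub> A"
  have a: "a \<in> carrier G"
    using A unfolding a_def G_def class_group_def carrier_FactGroup by (rule imageI)
  have a_pow: "a [^]\<^bsub>G\<^esub> k = \<P> #>\<^bsub>\<I>\<^esub> (A [^]\<^bsub>\<I>\<^esub> k)" for k :: nat
    unfolding a_def G_def class_group_def by (rule \<P>.FactGroup_pow[OF A])
  have one: "\<one>\<^bsub>G\<^esub> = \<P>"
    by (simp add: G_def class_group_def)
  have "a [^]\<^bsub>G\<^esub> (q ^ m) = \<one>\<^bsub>G\<^esub>"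
    unfolding a_pow one A_pow using \<alpha> \<open>\<alpha> \<noteq> 0\<close> \<O>_K principal_fractional
    by (intro \<I>.coset_join2 subgroup_principal principal_in) simp_all
  then have dvd: "G.ord a dvd q ^ m"
    using G.pow_eq_id[OF a] by simp
  have "\<not> G.ord a dvd q ^ (m - 1)"
  proof
    assume "G.ord a dvd q ^ (m - 1)"
    then have "a [^]\<^bsub>G\<^esub> (q ^ (m - 1)) = \<one>\<^bsub>G\<^esub>"
      using G.pow_eq_id[OF a] by simp
    then have "A [^]\<^bsub>\<I>\<^esub> (q ^ (m - 1)) \<in> \<P>"
      unfolding a_pow one
      using \<I>.nat_pow_closed[OF A] by (rule \<I>.coset_join1[OF _ _ subgroup_principal])
    then obtain \<beta> where \<beta>: "\<beta> \<in> K" "\<beta> \<noteq> 0" "A [^]\<^bsub>\<I>\<^esub> (q ^ (m - 1)) = principal \<beta>"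
      unfolding principal_iff by blast
    have "q ^ m = q ^ (m - 1) * q"
      using m by (simp flip: power_Suc2)
    then have "principal \<alpha> = principal (\<beta> ^ q)"
      using A_pow \<I>.nat_pow_pow[OF A, of "q ^ (m - 1)" q] principal_power[OF \<beta>(1,2)] \<beta>(3)
      by simp
    then obtain u where u: "u \<in> \<O>" "u * cnj u = 1" "\<alpha> = u * \<beta> ^ q"
      using \<beta>(2) by (elim principal_eqD) simp_all
    \<comment> \<open>The unit is absorbed into the power, as \<open>u\<close> is the \<open>q\<close>-th power of \<open>u ^ q\<close>.\<close>
    define \<gamma> where "\<gamma> = u ^ q * \<beta>"
    have \<gamma>_pow: "\<gamma> ^ q = \<alpha>"
      using unit_prime_power[OF u(1,2) q not3] by (simp add: \<gamma>_def u(3) power_mult_distrib)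
    have "algebraic_int \<gamma>"
    proof (rule algebraic_int_root[of \<alpha> "Polynomial.monom 1 q"])
      show "algebraic_int \<alpha>"
        using \<alpha> by (simp add: \<O>_def)
      show "poly (Polynomial.monom 1 q) \<gamma> = \<alpha>"
        using \<gamma>_pow by (simp add: poly_monom)
      show "Polynomial.lead_coeff (Polynomial.monom 1 q :: complex poly) = 1"
        by (simp add: Polynomial.degree_monom_eq)
      show "Polynomial.degree (Polynomial.monom 1 q :: complex poly) > 0"
        using \<open>q > 0\<close> by (simp add: Polynomial.degree_monom_eq)
    qed simp
    moreover have "\<gamma> \<in> K"
      unfolding \<gamma>_def by (intro K_mult \<O>_K[OF \<O>_power] u(1) \<beta>(1))
    ultimately have "\<gamma> \<in> \<O>"
      by (simp add: \<O>_def)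
    then have "\<gamma> ^ q + cnj \<gamma> ^ q \<noteq> of_nat q"
      by (rule trace_prime_power_neq[OF _ q])
    moreover have "cnj \<gamma> ^ q = cnj \<alpha>"
      by (simp flip: \<gamma>_pow)
    ultimately show False
      using trace by (simp add: \<gamma>_pow)
  qed
  obtain i where i: "i \<le> m" "G.ord a = q ^ i"
    using dvd divides_primepow_nat[OF q(1)] by blast
  have "i = m"
  proof (rule ccontr)
    assume "i \<noteq> m"
    then have "i \<le> m - 1"
      using i(1) by simp
    then show False
      using \<open>\<not> G.ord a dvd q ^ (m - 1)\<close> i(2) by (simp add: le_imp_power_dvd)
  qed
  then show ?thesis
    using G.ord_dvd_group_order[OF a] i(2) by (simp add: class_number_def G_def)
qed

end

section \<open>The radicand \<open>q\<^sup>2 - 4 p ^ (q ^ m)\<close>\<close>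

lemma square_less_four_mult_two_power: "(n :: nat)\<^sup>2 < 4 * 2 ^ n"
proof (induction n)
  case (Suc n)
  have "(Suc n)\<^sup>2 = n\<^sup>2 + 2 * n + 1"
    by (simp add: power2_eq_square)
  also have "\<dots> < 4 * 2 ^ n + 4 * 2 ^ n"
    using Suc.IH less_exp[of n] by linarith
  finally show ?case
    by simp
qed simp

lemma radicand_negative:
  fixes p q m :: nat
  assumes "p \<ge> 2" "q \<ge> 1" "m \<ge> 1"
  shows "(int q)\<^sup>2 - 4 * int p ^ (q ^ m) < 0"
proof -
  have "q\<^sup>2 < 4 * 2 ^ q"
    by (rule square_less_four_mult_two_power)
  also have "(2 :: nat) ^ q \<le> 2 ^ (q ^ m)"
    using assms self_le_power[of q m] by (intro power_increasing) simp_all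
  also have "(2 :: nat) ^ (q ^ m) \<le> p ^ (q ^ m)"
    using assms(1) by (intro power_mono) simp_all
  finally have "q\<^sup>2 < 4 * p ^ (q ^ m)"
    by simp
  then have "int (q\<^sup>2) < int (4 * p ^ (q ^ m))"
    by (simp only: of_nat_less_iff)
  then show ?thesis
    by simp
qed

theorem theorem4p1:
  fixes p q m :: nat
  assumes "Factorial_Ring.prime p" and "Factorial_Ring.prime q" and "p \<noteq> q" and "q \<ge> 3" and "m \<ge> 1"
  defines "K \<equiv> quadratic_field ((int q)\<^sup>2 - 4 * int p ^ (q ^ m))"
  shows "finite (carrier (class_group K)) \<and> q ^ m dvd class_number K"
proof -
  note p = assms(1) and q = assms(2) and m = assms(5)
  define D where "D = (int q)\<^sup>2 - 4 * int p ^ (q ^ m)"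
  interpret imaginary_quadratic D
    using radicand_negative[of p q m] prime_ge_2_nat[OF p] assms(4,5)
    by unfold_locales (simp add: D_def)
  have "odd q"
    using prime_odd_nat[OF q] assms(4) by simp
  define \<alpha> where "\<alpha> = (of_nat q + sqrtD) / 2"
  have trace: "\<alpha> + cnj \<alpha> = of_nat q"
    by (simp add: \<alpha>_def cnj_sqrtD field_simps)
  have "\<alpha> * cnj \<alpha> = (of_nat q * of_nat q - sqrtD * sqrtD) / 4"
    by (simp add: \<alpha>_def cnj_sqrtD field_simps)
  also have "\<dots> = of_int (int p) ^ (q ^ m)"
    unfolding sqrtD_square by (simp add: D_def power2_eq_square)
  finally have norm: "\<alpha> * cnj \<alpha> = of_int (int p) ^ (q ^ m)" .
  have "\<alpha> \<in> quadratic_field D"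
    unfolding \<alpha>_def divide_inverse
    by (intro K_mult K_add K_sqrtD K_Rats K_inverse) simp_all
  then have "\<alpha> \<in> \<O>"
    by (simp add: \<O>_iff trace norm)
  have "Rings.coprime (int q) (int p)"
    using primes_coprime[OF q p] assms(3) by simp
  moreover have "\<not> (q = 3 \<and> 3 dvd D)"
  proof
    assume *: "q = 3 \<and> 3 dvd D"
    then have "3 dvd 3 * 3 - D"
      by (intro dvd_diff) simp_all
    then have "3 dvd 4 * int p ^ (q ^ m)"
      using * by (simp add: D_def power2_eq_square)
    then have "(3 :: int) dvd 4 \<or> 3 dvd int p ^ (q ^ m)"
      by (intro prime_dvd_multD) simp_all
    then have "(3 :: int) dvd int p"
      using prime_dvd_power[of "3 :: int" "int p" "q ^ m"] by simp
    then have "3 dvd p"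
      by presburger
    then have "p = q"
      using * p primes_dvd_imp_eq[of 3 p] by simp
    then show False
      using assms(3) by simp
  qed
  ultimately have "q ^ m dvd class_number (quadratic_field D)"
    using prime_power_dvd_class_number[of "int p" q m \<alpha>] prime_gt_0_nat[OF p]
      q \<open>odd q\<close> m \<open>\<alpha> \<in> \<O>\<close> norm trace by simp
  then show ?thesis
    using finite_class_group by (simp add: K_def D_def)
qed

end
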